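(* Let $\sigma$ be a closed convex curve in $\mathbb R^2$ such that $\kappa_\sigma(q) \ge \kappa >0$ for a.e. $q\in \sigma$. Then $\kappa_{\sigma, 0} \ge \kappa$ globally, i.e. $\kappa_0(I)\ge\kappa$ for every subarc $I$ of $\sigma$.
   Context: For a subarc $I$ of $\sigma$ with endpoints $p,q$, $\kappa_0(I)$ is the curvature $\kappa$ of the circular arc in $\mathbb R^2$ of constant curvature $\kappa$ having the same length as $I$ and the same chord length $|pq|$. The arc/chord curvature $\kappa_\sigma(q)$ is the common value of $\liminf$ and $\limsup$ of $\kappa_0(I)$ over subarcs $I$ containing $q$ with $|I|\to0$ (it exists almost everywhere for convex curves). *)

theory Defs
  imports "HOL-Analysis.Analysis" "HOL-Library.Liminf_Limsup"
begin

definition curve_length :: "(real \<Rightarrow> 'a::metric_space) \<Rightarrow> real \<Rightarrow> real \<Rightarrow> ereal" where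
  "curve_length \<gamma> a b =
     (SUP ts \<in> {ts. sorted ts \<and> ts \<noteq> [] \<and> hd ts = a \<and> last ts = b}.
        ereal (\<Sum>i < length ts - 1. dist (\<gamma> (ts ! i)) (\<gamma> (ts ! Suc i))))"

text \<open>Curvature of the circular arc (of constant curvature k, a segment if k = 0) in the plane
having length L and chord length c: the unique k with 0 \<le> k \<le> 2 pi / L such that
the chord of an arc of length L and curvature k equals c, i.e. c = 2 sin(kL/2)/k
(and c = L when k = 0).\<close>
definition arc_chord_kappa :: "real \<Rightarrow> real \<Rightarrow> real" where
  "arc_chord_kappa L c =
     (THE k. 0 \<le> k \<and> k * L \<le> 2 * pi \<and>
             (if k = 0 then c = L else k * c = 2 * sin (k * L / 2)))"

definition kappa0 :: "(real \<Rightarrow> real^2) \<Rightarrow> real \<Rightarrow> real \<Rightarrow> real" where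
  "kappa0 \<gamma> a b = arc_chord_kappa (real_of_ereal (curve_length \<gamma> a b)) (dist (\<gamma> a) (\<gamma> b))"

definition subarcs_at :: "real \<Rightarrow> (real \<times> real) filter" where
  "subarcs_at s = at (s, s) within {(a, b). a \<le> s \<and> s \<le> b \<and> a < b}"

definition closed_convex_curve_al :: "(real \<Rightarrow> real^2) \<Rightarrow> real \<Rightarrow> bool" where
  "closed_convex_curve_al \<gamma> L \<longleftrightarrow>
     0 < L \<and> (\<forall>t. \<gamma> (t + L) = \<gamma> t) \<and> inj_on \<gamma> {0..<L} \<and>
     (\<forall>a b. a \<le> b \<longrightarrow> curve_length \<gamma> a b = ereal (b - a)) \<and>
     (\<exists>C. convex C \<and> compact C \<and> interior C \<noteq> {} \<and> \<gamma> ` {0..L} = frontier C)"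

end

theory Submission
  imports Defs
begin

text \<open>
  Cut the arc at the point \<open>s\<^sub>0\<close> farthest from its chord. On each half the directions of the
  inscribed chords turn monotonically through angles in \<open>[0, \<pi>]\<close>, measured from the direction of
  the chord; let \<open>\<theta>(s)\<close> be the infimum of the directions occurring after \<open>s\<close>. If on all short
  intervals containing \<open>x\<close> the function \<open>\<theta>\<close> grew at rate at most \<open>m < \<kappa>\<close>, the chords of the arcs
  centred at \<open>x\<close> would be at least as long as those of a circle of curvature \<open>m\<close>, against the
  hypothesis at \<open>x\<close>. So almost every \<open>x\<close> lies in arbitrarily short intervals on which \<open>\<theta>\<close> grows
  at rate at least \<open>m\<close>, and Vitali's covering theorem gives \<open>\<theta>(s) \<ge> \<kappa> |s - s\<^sub>0|\<close>. As in Schur's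
  comparison theorem, the projections of the two halves to the chord are then at most
  \<open>sin \<alpha> / \<kappa>\<close> and \<open>sin \<beta> / \<kappa>\<close>, with \<open>\<alpha>, \<beta> \<le> \<pi>\<close> and \<open>\<alpha> + \<beta>\<close> equal to \<open>\<kappa>\<close> times the length of the
  arc, and \<open>sin \<alpha> + sin \<beta> \<le> 2 sin ((\<alpha> + \<beta>) / 2)\<close>.
\<close>

section \<open>Circular arcs\<close>

text \<open>sin t / t is strictly decreasing on (0, pi]: its derivative has the sign of t cos t -
  sin t, which vanishes at 0 and has derivative - t sin t.\<close>

lemma mult_sin_strict_antimono:
  fixes x y :: real
  assumes "0 < x" "x < y" "y \<le> pi"
  shows "x * sin y < y * sin x"
proof -
  have neg: "t * cos t - sin t < 0" if "0 < t" "t < pi" for t :: real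
  proof -
    have "t * cos t - sin t < 0 * cos 0 - sin 0"
    proof (rule DERIV_neg_imp_decreasing_open[where f = "\<lambda>t. t * cos t - sin t"])
      fix u assume "0 < u" "u < t"
      then show "\<exists>z. ((\<lambda>t. t * cos t - sin t) has_real_derivative z) (at u) \<and> z < 0"
        using that by (intro exI[of _ "- (u * sin u)"]) (auto intro!: derivative_eq_intros mult_pos_pos sin_gt_zero)
    qed (use that in \<open>auto intro!: continuous_intros\<close>)
    then show ?thesis by simp
  qed
  have "sin y / y < sin x / x"
  proof (rule DERIV_neg_imp_decreasing_open[where f = "\<lambda>t. sin t / t"])
    fix u assume u: "x < u" "u < y"
    then show "\<exists>z. ((\<lambda>t. sin t / t) has_real_derivative z) (at u) \<and> z < 0"
      using assms neg[of u]
      by (intro exI[of _ "(u * cos u - sin u) / u\<^sup>2"])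
        (auto intro!: derivative_eq_intros simp: divide_simps power2_eq_square)
  qed (use assms in \<open>auto intro!: continuous_intros\<close>)
  then show ?thesis using assms by (simp add: field_simps)
qed

text \<open>The condition under the \<open>THE\<close> of \<open>arc_chord_kappa\<close>, named so
  that existence and uniqueness can be stated. The bound \<open>2 * pi\<close> admits at most one
  full turn.\<close>

definition is_arc_curvature :: "real \<Rightarrow> real \<Rightarrow> real \<Rightarrow> bool" where
  "is_arc_curvature l c k \<longleftrightarrow>
     0 \<le> k \<and> k * l \<le> 2 * pi \<and> (if k = 0 then c = l else k * c = 2 * sin (k * l / 2))"

text \<open>For fixed length the chord 2 sin (k l / 2) / k shrinks as the curvature grows, because
  sin t / t decreases. This turns the curvature hypothesis into a chord bound.\<close>

lemma arc_curvature_chord_less: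
  assumes k: "is_arc_curvature l c k" and "0 < l" "0 < m" "m < k"
  shows "m * c < 2 * sin (m * l / 2)"
proof -
  have "(m * l / 2) * sin (k * l / 2) < (k * l / 2) * sin (m * l / 2)"
    using assms by (intro mult_sin_strict_antimono) (auto simp: is_arc_curvature_def)
  then have "m * sin (k * l / 2) < k * sin (m * l / 2)"
    using \<open>0 < l\<close> by (simp add: field_simps)
  moreover have "k * c = 2 * sin (k * l / 2)"
    using assms by (auto simp: is_arc_curvature_def split: if_splits)
  then have "m * sin (k * l / 2) = k * (m * c / 2)" by (simp add: algebra_simps)
  ultimately have "k * (m * c / 2) < k * sin (m * l / 2)" by simp
  then show ?thesis using assms by simp
qed

text \<open>The same monotonicity read in the other direction. It gives uniqueness of the arc
  curvature and, by contraposition, turns the final chord estimate back into a curvature bound;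
  \<open>m * l \<le> 2 * pi\<close> keeps the half-angles at most pi.\<close>

lemma arc_curvature_chord_greater:
  assumes k: "is_arc_curvature l c k" and "0 < l" "k < m" "m * l \<le> 2 * pi"
  shows "2 * sin (m * l / 2) < m * c"
proof (cases "k = 0")
  case True
  then have "c = l" using k by (simp add: is_arc_curvature_def)
  moreover have "sin (m * l / 2) < m * l / 2"
  proof -
    define x where "x = m * l / 2"
    have x: "0 < x" "x \<le> pi" using assms True by (auto simp: x_def)
    then have "(x / 2) * sin x < x * sin (x / 2)" by (intro mult_sin_strict_antimono) auto
    then have "sin x < 2 * sin (x / 2)" using x by simp
    also have "\<dots> \<le> x" using sin_x_le_x[of "x / 2"] x by simp
    finally show ?thesis by (simp add: x_def)
  qed
  ultimately show ?thesis by (simp add: field_simps)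
next
  case False
  then have "0 < k" using k by (simp add: is_arc_curvature_def)
  have "(k * l / 2) * sin (m * l / 2) < (m * l / 2) * sin (k * l / 2)"
    using assms \<open>0 < k\<close> by (intro mult_sin_strict_antimono) auto
  then have "k * sin (m * l / 2) < m * sin (k * l / 2)"
    using \<open>0 < l\<close> by (simp add: field_simps)
  moreover have "k * c = 2 * sin (k * l / 2)"
    using k False by (auto simp: is_arc_curvature_def)
  then have "m * sin (k * l / 2) = k * (m * c / 2)" by (simp add: algebra_simps)
  ultimately have "k * sin (m * l / 2) < k * (m * c / 2)" by simp
  then show ?thesis using \<open>0 < k\<close> by simp
qed

text \<open>Intermediate value theorem for \<open>k * c - 2 * sin (k * l / 2)\<close>: if
  \<open>c < l\<close> it is negative for small positive \<open>k\<close>, since sin x / x tends to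
  1, and it is nonnegative at \<open>k = 2 * pi / l\<close>.\<close>

lemma is_arc_curvature_exists:
  assumes "0 \<le> c" "c \<le> l" "0 < l"
  shows "\<exists>k. is_arc_curvature l c k"
proof (cases "c = l")
  case True
  then show ?thesis by (intro exI[of _ 0]) (simp add: is_arc_curvature_def)
next
  case False
  have "((\<lambda>x::real. sin x / x) \<longlongrightarrow> 1) (at 0)"
    using DERIV_sin[of 0] by (simp add: DERIV_def)
  then have "eventually (\<lambda>x. sin x / x > c / l) (at (0::real))"
    using assms False by (intro order_tendstoD) auto
  then obtain d where d: "d > 0" "\<And>x::real. x \<noteq> 0 \<Longrightarrow> dist x 0 < d \<Longrightarrow> c / l < sin x / x"
    by (auto simp: eventually_at)
  define x where "x = min (d / 2) pi"
  have x: "0 < x" "x \<le> pi" "x < d" using d(1) pi_gt_zero by (auto simp: x_def min_def)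
  then have "c / l < sin x / x" by (intro d(2)) auto
  then have c1: "(2 * x / l) * c < 2 * sin x" using x assms by (simp add: field_simps)
  have "\<exists>k\<ge>2 * x / l. k \<le> 2 * pi / l \<and> k * c - 2 * sin (k * l / 2) = 0"
    using c1 x assms
    by (intro IVT'[of "\<lambda>k. k * c - 2 * sin (k * l / 2)"]) (auto simp: divide_right_mono intro!: continuous_intros)
  then obtain k where k: "2 * x / l \<le> k" "k \<le> 2 * pi / l" "k * c = 2 * sin (k * l / 2)" by auto
  have "0 < k" using k(1) x assms by (meson divide_pos_pos less_le_trans mult_pos_pos zero_less_numeral)
  then show ?thesis
    using k assms by (intro exI[of _ k]) (auto simp: is_arc_curvature_def field_simps)
qed

lemma is_arc_curvature_arc_chord_kappa:
  assumes "0 \<le> c" "c \<le> l" "0 < l"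
  shows "is_arc_curvature l c (arc_chord_kappa l c)"
proof -
  obtain k where k: "is_arc_curvature l c k"
    using is_arc_curvature_exists assms by blast
  have "k' = k" if "is_arc_curvature l c k'" for k'
  proof -
    have False if a: "is_arc_curvature l c k1" "is_arc_curvature l c k2" "k1 < k2" for k1 k2
    proof -
      have "k2 \<noteq> 0" using a by (auto simp: is_arc_curvature_def)
      then have "k2 * l \<le> 2 * pi" "k2 * c = 2 * sin (k2 * l / 2)"
        using a(2) by (simp_all add: is_arc_curvature_def)
      then show False using arc_curvature_chord_greater[OF a(1) \<open>0 < l\<close> a(3)] by simp
    qed
    then show ?thesis using that k by (meson linorder_neqE)
  qed
  then have "is_arc_curvature l c (THE k. is_arc_curvature l c k)"
    using theI[of "is_arc_curvature l c" k] k by blast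
  moreover have "arc_chord_kappa l c = (THE k. is_arc_curvature l c k)"
    unfolding arc_chord_kappa_def is_arc_curvature_def ..
  ultimately show ?thesis by simp
qed

section \<open>Comparison of increments\<close>

text \<open>Replaces the integration of a one-sided derivative bound.\<close>

lemma nonincreasing_if_quadratic_bound:
  fixes F :: "real \<Rightarrow> real"
  assumes "p \<le> q"
    and F: "\<And>s t. p \<le> s \<Longrightarrow> s < t \<Longrightarrow> t \<le> q \<Longrightarrow> F t - F s \<le> K * (t - s)\<^sup>2"
  shows "F q \<le> F p"
proof -
  \<comment> \<open>Over \<open>n\<close> equal pieces of length \<open>h\<close> the quadratic
    errors add up to n K h^2, which tends to 0 as \<open>n\<close> grows.\<close>
  have "F q - F p \<le> K * (q - p)\<^sup>2 / n" if n: "n > 0" for n :: nat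
  proof -
    define h where "h = (q - p) / n"
    have h: "h \<ge> 0" "n * h = q - p" using assms n by (auto simp: h_def)
    have step: "F (p + Suc i * h) - F (p + i * h) \<le> K * h\<^sup>2" if "i < n" for i
    proof (cases "h = 0")
      case False
      have eq: "real (Suc i) * h = real i * h + h" by (simp add: algebra_simps)
      have "real (Suc i) * h \<le> n * h" using that h(1) by (intro mult_right_mono) auto
      then have "p + real (Suc i) * h \<le> q" using h(2) by linarith
      moreover have "p \<le> p + i * h" "p + i * h < p + real (Suc i) * h"
        using False h(1) unfolding eq by auto
      ultimately have "F (p + Suc i * h) - F (p + i * h) \<le> K * ((p + Suc i * h) - (p + i * h))\<^sup>2"
        by (intro F)
      then show ?thesis unfolding eq by simp
    qed auto
    have "F q - F p = (\<Sum>i<n. F (p + Suc i * h) - F (p + i * h))"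
      using sum_lessThan_telescope[of "\<lambda>i. F (p + i * h)" n] h(2) by simp
    also have "\<dots> \<le> (\<Sum>i<n. K * h\<^sup>2)" using step by (intro sum_mono) auto
    also have "\<dots> = K * (q - p)\<^sup>2 / n" using n by (simp add: h_def power2_eq_square)
    finally show ?thesis .
  qed
  moreover have "(\<lambda>n. K * (q - p)\<^sup>2 / real n) \<longlonglongrightarrow> 0" by (rule lim_const_over_n)
  ultimately have "F q - F p \<le> 0"
    by (intro LIMSEQ_le_const[of _ 0 "F q - F p"] exI[of _ 1] allI impI) auto
  then show ?thesis by simp
qed

text \<open>\<open>F\<close> is controlled only by the value of \<open>f\<close> at some point of
  each piece. The mean value theorem gives \<open>G\<close> its own point, and the Lipschitz bound
  makes the mismatch quadratic in the length of the piece.\<close>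

lemma increment_le_of_difference_quotients:
  fixes F G f :: "real \<Rightarrow> real"
  assumes "p \<le> q"
    and G: "\<And>x. (G has_real_derivative f x) (at x)"
    and lip: "\<And>x y. \<bar>f x - f y\<bar> \<le> K * \<bar>x - y\<bar>" and "0 \<le> K"
    and F: "\<And>s t. p \<le> s \<Longrightarrow> s < t \<Longrightarrow> t \<le> q \<Longrightarrow> \<exists>\<xi>\<in>{s..t}. F t - F s \<le> (t - s) * f \<xi>"
  shows "F q - F p \<le> G q - G p"
proof -
  have "(F q - G q) \<le> (F p - G p)"
  proof (rule nonincreasing_if_quadratic_bound[of p q "\<lambda>t. F t - G t" K])
    fix s t assume st: "p \<le> s" "s < t" "t \<le> q"
    obtain \<xi> where \<xi>: "\<xi> \<in> {s..t}" "F t - F s \<le> (t - s) * f \<xi>" using F[OF st] by auto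
    obtain z where z: "s < z" "z < t" "G t - G s = (t - s) * f z"
      using MVT2[of s t G f] st G by auto
    have "f \<xi> - f z \<le> K * \<bar>\<xi> - z\<bar>" using lip[of \<xi> z] by linarith
    also have "\<dots> \<le> K * (t - s)" using \<xi> z \<open>0 \<le> K\<close> by (intro mult_left_mono) auto
    finally have "(t - s) * (f \<xi> - f z) \<le> (t - s) * (K * (t - s))"
      using st by (intro mult_left_mono) auto
    then show "(F t - G t) - (F s - G s) \<le> K * (t - s)\<^sup>2"
      using \<xi>(2) z(3) by (simp add: power2_eq_square algebra_simps)
  qed fact
  then show ?thesis by simp
qed

lemma cos_lipschitz: "\<bar>cos x - cos y\<bar> \<le> \<bar>x - y\<bar>" for x y :: real
proof -
  have *: "\<bar>cos x - cos y\<bar> \<le> \<bar>x - y\<bar>" if "x < y" for x y :: real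
  proof -
    obtain z where "cos y - cos x = (y - x) * (- sin z)"
      using MVT2[OF \<open>x < y\<close>, of cos "\<lambda>z. - sin z"] DERIV_cos by blast
    then have "\<bar>cos x - cos y\<bar> = \<bar>x - y\<bar> * \<bar>sin z\<bar>" by (metis abs_minus_commute abs_mult abs_minus_cancel)
    then show ?thesis by (simp add: mult_left_le)
  qed
  show ?thesis using *[of x y] *[of y x] by (cases x y rule: linorder_cases) auto
qed

text \<open>The bound is the integral of cos (k (t - x)) over [p, q]: the progress of an arc of
  curvature \<open>k\<close> in its direction at \<open>x\<close>.\<close>

lemma increment_le_integral_cos:
  fixes F :: "real \<Rightarrow> real"
  assumes "p \<le> q" "0 < k"
    and F: "\<And>s t. p \<le> s \<Longrightarrow> s < t \<Longrightarrow> t \<le> q \<Longrightarrow> \<exists>\<xi>\<in>{s..t}. F t - F s \<le> (t - s) * cos (k * (\<xi> - x))"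
  shows "F q - F p \<le> (sin (k * (q - x)) - sin (k * (p - x))) / k"
proof -
  have "F q - F p \<le> sin (k * (q - x)) / k - sin (k * (p - x)) / k"
  proof (rule increment_le_of_difference_quotients[where f = "\<lambda>t. cos (k * (t - x))" and K = k])
    show "\<bar>cos (k * (t - x)) - cos (k * (s - x))\<bar> \<le> k * \<bar>t - s\<bar>" for s t
      using cos_lipschitz[of "k * (t - x)" "k * (s - x)"] \<open>0 < k\<close>
      by (simp add: abs_mult flip: right_diff_distrib)
    show "((\<lambda>t. sin (k * (t - x)) / k) has_real_derivative cos (k * (t - x))) (at t)" for t
      using \<open>0 < k\<close> by (auto intro!: derivative_eq_intros)
  qed (use \<open>p \<le> q\<close> \<open>0 < k\<close> F in auto)
  then show ?thesis by (simp add: diff_divide_distrib)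
qed

lemma increment_ge_integral_cos:
  fixes F :: "real \<Rightarrow> real"
  assumes "p \<le> q" "0 < k"
    and F: "\<And>s t. p \<le> s \<Longrightarrow> s < t \<Longrightarrow> t \<le> q \<Longrightarrow> \<exists>\<xi>\<in>{s..t}. (t - s) * cos (k * (\<xi> - x)) \<le> F t - F s"
  shows "(sin (k * (q - x)) - sin (k * (p - x))) / k \<le> F q - F p"
proof -
  have "(- F q) - (- F p) \<le> (- sin (k * (q - x)) / k) - (- sin (k * (p - x)) / k)"
  proof (rule increment_le_of_difference_quotients[where f = "\<lambda>t. - cos (k * (t - x))" and K = k])
    show "\<bar>- cos (k * (t - x)) - - cos (k * (s - x))\<bar> \<le> k * \<bar>t - s\<bar>" for s t
      using cos_lipschitz[of "k * (s - x)" "k * (t - x)"] \<open>0 < k\<close>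
      by (simp add: abs_mult abs_minus_commute flip: right_diff_distrib)
    show "\<exists>\<xi>\<in>{s..t}. - F t - - F s \<le> (t - s) * - cos (k * (\<xi> - x))" if "p \<le> s" "s < t" "t \<le> q" for s t
      using F[OF that] by force
    show "((\<lambda>t. - sin (k * (t - x)) / k) has_real_derivative - cos (k * (t - x))) (at t)" for t
      using \<open>0 < k\<close> by (auto intro!: derivative_eq_intros)
  qed (use \<open>p \<le> q\<close> \<open>0 < k\<close> in auto)
  then show ?thesis by (simp add: diff_divide_distrib)
qed

section \<open>Lengths of curves and growth of monotone functions\<close>

lemma dist_le_curve_length:
  assumes "s \<le> t"
  shows "ereal (dist (\<gamma> s) (\<gamma> t)) \<le> curve_length \<gamma> s t"
  unfolding curve_length_def using assms by (intro SUP_upper2[of "[s, t]"]) auto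

text \<open>The chord inequality is summed over inscribed polygons and passes to their
  supremum.\<close>

lemma curve_length_chord_bound:
  fixes g :: "real \<Rightarrow> complex"
  assumes "s \<le> t" and len: "curve_length g s t = ereal (t - s)"
    and chord: "\<And>w z. s \<le> w \<Longrightarrow> w < z \<Longrightarrow> z \<le> t \<Longrightarrow> m * dist (g w) (g z) \<le> Re (v * (g z - g w))"
  shows "m * (t - s) \<le> Re (v * (g t - g s))"
\<comment> \<open>For \<open>m \<le> 0\<close> the supremum bounds the wrong side; here the single
  chord from \<open>s\<close> to \<open>t\<close> suffices, being no longer than
  \<open>t - s\<close>.\<close>
proof (cases "m \<le> 0 \<or> s = t")
  case True
  have "dist (g s) (g t) \<le> t - s" using dist_le_curve_length[of s t g] assms by simp
  show ?thesis
  proof (cases "s = t")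
    case False
    then have "m * (t - s) \<le> m * dist (g s) (g t)"
      using True \<open>dist (g s) (g t) \<le> t - s\<close> by (intro mult_left_mono_neg) auto
    also have "\<dots> \<le> Re (v * (g t - g s))" using chord[of s t] False \<open>s \<le> t\<close> by simp
    finally show ?thesis .
  qed simp
next
  case False
  then have "m > 0" by simp
  have "curve_length g s t \<le> ereal (Re (v * (g t - g s)) / m)"
    unfolding curve_length_def
  proof (rule SUP_least)
    fix ts assume "ts \<in> {ts. sorted ts \<and> ts \<noteq> [] \<and> hd ts = s \<and> last ts = t}"
    then have ts: "sorted ts" "ts \<noteq> []" "ts ! 0 = s" "ts ! (length ts - 1) = t"
      by (auto simp: hd_conv_nth last_conv_nth)
    have "m * (\<Sum>i<length ts - 1. dist (g (ts ! i)) (g (ts ! Suc i)))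
        = (\<Sum>i<length ts - 1. m * dist (g (ts ! i)) (g (ts ! Suc i)))"
      by (rule sum_distrib_left)
    also have "\<dots> \<le> (\<Sum>i<length ts - 1. Re (v * (g (ts ! Suc i) - g (ts ! i))))"
    proof (rule sum_mono)
      fix i assume "i \<in> {..<length ts - 1}"
      then have "ts ! 0 \<le> ts ! i" "ts ! i \<le> ts ! Suc i" "ts ! Suc i \<le> ts ! (length ts - 1)"
        using ts(1) by (auto intro!: sorted_nth_mono)
      then show "m * dist (g (ts ! i)) (g (ts ! Suc i)) \<le> Re (v * (g (ts ! Suc i) - g (ts ! i)))"
        using chord[of "ts ! i" "ts ! Suc i"] ts by (cases "ts ! i = ts ! Suc i") auto
    qed
    also have "\<dots> = (\<Sum>i<length ts - 1. Re (v * g (ts ! Suc i)) - Re (v * g (ts ! i)))"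
      by (simp add: right_diff_distrib)
    also have "\<dots> = Re (v * (g t - g s))"
      unfolding sum_lessThan_telescope[of "\<lambda>i. Re (v * g (ts ! i))"] ts by (simp add: right_diff_distrib)
    finally show "ereal (\<Sum>i<length ts - 1. dist (g (ts ! i)) (g (ts ! Suc i)))
        \<le> ereal (Re (v * (g t - g s)) / m)"
      using \<open>m > 0\<close> by (simp add: field_simps)
  qed
  then show ?thesis using len \<open>m > 0\<close> by (simp add: field_simps)
qed

section \<open>Growth of monotone functions and Vitali coverings\<close>

lemma sum_increments_disjoint_intervals_le:
  fixes \<theta> :: "real \<Rightarrow> real"
  assumes "finite F" and "mono_on {p..q} \<theta>" and "p \<le> q"
    and "\<And>u v. (u, v) \<in> F \<Longrightarrow> p \<le> u \<and> u < v \<and> v \<le> q"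
    and "pairwise (\<lambda>I J. disjnt {fst I..snd I} {fst J..snd J}) F"
  shows "(\<Sum>(u, v)\<in>F. \<theta> v - \<theta> u) \<le> \<theta> q - \<theta> p"
  using assms
\<comment> \<open>The inserted interval has the largest right endpoint, so by disjointness the
  others end no later than its left endpoint \<open>u\<close>; the induction hypothesis is applied
  with \<open>u\<close> in place of \<open>q\<close>.\<close>
proof (induction F arbitrary: q rule: finite_ranking_induct[where f = snd])
  case empty
  then show ?case by (auto simp: mono_on_def)
next
  case (insert I S)
  obtain u v where I: "I = (u, v)" by (cases I)
  have uv: "p \<le> u" "u < v" "v \<le> q" using insert.prems(3)[of u v] I by auto
  show ?case
  proof (cases "I \<in> S")
    case True
    then show ?thesis using insert.IH[of q] insert.prems by (simp add: insert_absorb)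
  next
    case False
    have le_u: "v' \<le> u" if "(u', v') \<in> S" for u' v'
    proof (rule ccontr)
      assume "\<not> v' \<le> u"
      moreover have "v' \<le> v" using insert.hyps(2)[OF that] I by simp
      moreover have "disjnt {u'..v'} {u..v}"
        using insert.prems(4) that False I unfolding pairwise_def by fastforce
      moreover have "u' < v'" using insert.prems(3)[of u' v'] that by auto
      ultimately show False unfolding disjnt_iff by (metis atLeastAtMost_iff less_imp_le not_le order.refl)
    qed
    have "(\<Sum>(u, v)\<in>S. \<theta> v - \<theta> u) \<le> \<theta> u - \<theta> p"
    proof (rule insert.IH)
      show "mono_on {p..u} \<theta>" by (rule mono_on_subset[OF insert.prems(1)]) (use uv in auto)
      show "pairwise (\<lambda>I J. disjnt {fst I..snd I} {fst J..snd J}) S"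
        by (rule pairwise_subset[OF insert.prems(4)]) auto
    qed (use uv le_u insert.prems(3) in auto)
    moreover have "\<theta> v \<le> \<theta> q" using insert.prems(1) uv by (auto simp: mono_on_def)
    ultimately show ?thesis using False insert.hyps(1) I by simp
  qed
qed

text \<open>The upper derivative suffices, since Vitali's theorem extracts disjoint intervals of fast
  growth that cover almost everything.\<close>

lemma mono_growth_from_small_intervals:
  fixes \<theta> :: "real \<Rightarrow> real"
  assumes mono: "mono_on {p..q} \<theta>" and "p \<le> q" "0 < k" and N: "negligible N"
    and small: "\<And>x d. p < x \<Longrightarrow> x < q \<Longrightarrow> x \<notin> N \<Longrightarrow> 0 < d \<Longrightarrow>
      \<exists>u v. p \<le> u \<and> u \<le> x \<and> x \<le> v \<and> v \<le> q \<and> u < v \<and> v - u < d \<and> k * (v - u) \<le> \<theta> v - \<theta> u"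
  shows "k * (q - p) \<le> \<theta> q - \<theta> p"
proof -
  define K where "K = {(u, v). p \<le> u \<and> u < v \<and> v \<le> q \<and> k * (v - u) \<le> \<theta> v - \<theta> u}"
  \<comment> \<open>Vitali's theorem speaks of balls, so an interval is encoded by its midpoint and
    half-length.\<close>
  define m where "m = (\<lambda>I :: real \<times> real. (fst I + snd I) / 2)"
  define r where "r = (\<lambda>I :: real \<times> real. (snd I - fst I) / 2)"
  have cb: "cball (m I) (r I) = {fst I..snd I}" for I
    by (auto simp: m_def r_def cball_eq_atLeastAtMost field_simps)
  obtain C where C: "countable C" "C \<subseteq> K"
    "pairwise (\<lambda>I J. disjnt (cball (m I) (r I)) (cball (m J) (r J))) C"
    "negligible (({p<..<q} - N) - (\<Union>I\<in>C. cball (m I) (r I)))"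
  proof (rule Vitali_covering_theorem_cballs[of K r "{p<..<q} - N" m])
    show "0 < r I" if "I \<in> K" for I using that by (auto simp: K_def r_def)
    show "\<exists>I. I \<in> K \<and> x \<in> cball (m I) (r I) \<and> r I < d" if x: "x \<in> {p<..<q} - N" and "0 < d" for x d
    proof -
      obtain u v where "p \<le> u" "u \<le> x" "x \<le> v" "v \<le> q" "u < v" "v - u < d" "k * (v - u) \<le> \<theta> v - \<theta> u"
        using small[of x d] x \<open>0 < d\<close> by auto
      then show ?thesis unfolding cb by (intro exI[of _ "(u, v)"]) (auto simp: K_def r_def)
    qed
  qed
  define D where "D = (\<lambda>I :: real \<times> real. {fst I..snd I}) ` C"
  \<comment> \<open>Finitely many of the disjoint intervals have total length at most the increment
    of \<theta> divided by \<open>k\<close>. The countable union then follows by approximation in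
    measure.\<close>
  have bound: "measure lebesgue (\<Union>D') \<le> (\<theta> q - \<theta> p) / k" if D': "D' \<subseteq> D" "finite D'" for D'
  proof -
    obtain F where F: "F \<subseteq> C" "finite F" "D' = (\<lambda>I. {fst I..snd I}) ` F"
      using D' unfolding D_def by (meson finite_subset_image)
    have "measure lebesgue (\<Union>D') \<le> (\<Sum>I\<in>F. measure lebesgue {fst I..snd I})"
      unfolding F(3) by (rule measure_UNION_le) (use F in auto)
    also have "\<dots> = (\<Sum>(u, v)\<in>F. v - u)"
      using F(1) C(2) by (intro sum.cong) (auto simp: K_def)
    finally have "k * measure lebesgue (\<Union>D') \<le> k * (\<Sum>(u, v)\<in>F. v - u)"
      using \<open>0 < k\<close> by simp
    also have "\<dots> = (\<Sum>(u, v)\<in>F. k * (v - u))" by (simp add: sum_distrib_left case_prod_unfold)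
    also have "\<dots> \<le> (\<Sum>(u, v)\<in>F. \<theta> v - \<theta> u)"
      using F(1) C(2) by (intro sum_mono) (auto simp: K_def)
    also have "\<dots> \<le> \<theta> q - \<theta> p"
    proof (rule sum_increments_disjoint_intervals_le)
      show "pairwise (\<lambda>I J. disjnt {fst I..snd I} {fst J..snd J}) F"
        using pairwise_subset[OF C(3) F(1)] by (simp add: cb)
    qed (use F C(2) mono \<open>p \<le> q\<close> in \<open>auto simp: K_def\<close>)
    finally show ?thesis using \<open>0 < k\<close> by (simp add: field_simps)
  qed
  have D: "countable D" "\<And>d. d \<in> D \<Longrightarrow> d \<in> lmeasurable" using C(1) by (auto simp: D_def)
  have le: "measure lebesgue (\<Union>D) \<le> (\<theta> q - \<theta> p) / k"
  proof (rule field_le_epsilon)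
    fix e :: real assume "e > 0"
    then obtain D' where "D' \<subseteq> D" "finite D'" "measure lebesgue (\<Union>D) - e < measure lebesgue (\<Union>D')"
      using measure_countable_Union_approachable[OF D(1) _ D(2) bound] by blast
    then show "measure lebesgue (\<Union>D) \<le> (\<theta> q - \<theta> p) / k + e" using bound[of D'] by linarith
  qed
  \<comment> \<open>A null set containing all points of (p, q) outside the chosen intervals.\<close>
  define Z where "Z = N \<union> (({p<..<q} - N) - \<Union>D)"
  have Z: "negligible Z" using N C(4) by (auto simp: Z_def D_def cb)
  have UD: "\<Union>D \<in> lmeasurable"
  proof (rule fmeasurableI2[of "{p..q}"])
    show "\<Union>D \<subseteq> {p..q}" using C(2) by (fastforce simp: D_def K_def)
    show "\<Union>D \<in> sets lebesgue" using D by (intro sets.countable_Union) (auto simp: fmeasurableD)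
  qed auto
  have "q - p = measure lebesgue {p<..<q}" using \<open>p \<le> q\<close> by simp
  also have "\<dots> \<le> measure lebesgue (\<Union>D \<union> Z)"
    using UD negligible_imp_measurable[OF Z] by (intro measure_mono_fmeasurable) (auto simp: Z_def)
  also have "\<dots> \<le> measure lebesgue (\<Union>D) + measure lebesgue Z"
    using UD negligible_imp_measurable[OF Z] by (intro measure_Un_le) auto
  also have "\<dots> \<le> (\<theta> q - \<theta> p) / k" using le negligible_imp_measure0[OF Z] by simp
  finally show ?thesis using \<open>0 < k\<close> by (simp add: field_simps)
qed

section \<open>Comparison for half an arc\<close>

text \<open>A lower curvature bound at \<open>x\<close> in chord form: 2 sin (m r) / m is the chord
  of an arc of length 2 r and curvature \<open>m\<close>. Speaking of distances only, it is carried
  over by isometries and by reversal of the parameter.\<close>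

definition short_chords :: "(real \<Rightarrow> 'a::metric_space) \<Rightarrow> real \<Rightarrow> real \<Rightarrow> bool" where
  "short_chords g k x \<longleftrightarrow>
     (\<forall>m. 0 < m \<and> m < k \<longrightarrow> (\<exists>\<delta>>0. \<forall>r. 0 < r \<and> r < \<delta> \<longrightarrow> m * dist (g (x - r)) (g (x + r)) < 2 * sin (m * r)))"

lemma Re_cis_mult_Arg: "Re (cis (- \<phi>) * z) = cmod z * cos (Arg z - \<phi>)"
proof -
  have "cis (- \<phi>) * z = cis (- \<phi>) * rcis (cmod z) (Arg z)" by (simp add: rcis_cmod_Arg)
  also have "\<dots> = rcis (cmod z) (Arg z - \<phi>)" by (simp add: rcis_def cis_mult algebra_simps)
  finally show ?thesis by simp
qed

lemma cos_le_cos_of_abs_le: "\<bar>x\<bar> \<le> M \<Longrightarrow> M \<le> pi \<Longrightarrow> cos M \<le> cos x" for x M :: real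
  using cos_monotone_0_pi_le[of "\<bar>x\<bar>" M] by simp

text \<open>\<open>Arg\<close> measures directions from the real axis, onto which the chord of the
  whole arc will be rotated; \<open>up\<close> keeps them in [0, pi], where \<open>Arg\<close> does
  not jump.\<close>

lemma half_arc_comparison:
  fixes g :: "real \<Rightarrow> complex"
  assumes "s\<^sub>0 \<le> b" "0 < k"
    and len: "\<And>s t. s\<^sub>0 \<le> s \<Longrightarrow> s \<le> t \<Longrightarrow> t \<le> b \<Longrightarrow> curve_length g s t = ereal (t - s)"
    and up: "\<And>s t. s\<^sub>0 \<le> s \<Longrightarrow> s \<le> t \<Longrightarrow> t \<le> b \<Longrightarrow> Im (g s) \<le> Im (g t)"
    and turn: "\<And>s t w. s\<^sub>0 \<le> s \<Longrightarrow> s < t \<Longrightarrow> t < w \<Longrightarrow> w \<le> b \<Longrightarrow> Arg (g t - g s) \<le> Arg (g w - g t)"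
    and N: "negligible N" and good: "\<And>x. x \<notin> N \<Longrightarrow> short_chords g k x"
  shows "k * (b - s\<^sub>0) \<le> pi" "Re (g b) - Re (g s\<^sub>0) \<le> sin (k * (b - s\<^sub>0)) / k"
proof -
  \<comment> \<open>\<open>pi\<close> keeps the set nonempty at \<open>s = b\<close>, where no chord
    remains; since \<open>Arg\<close> never exceeds \<open>pi\<close>, it changes no infimum for
    \<open>s < b\<close>.\<close>
  define A where "A = (\<lambda>s. insert pi {Arg (g z - g w) | w z. s \<le> w \<and> w < z \<and> z \<le> b})"
  define \<theta> where "\<theta> = (\<lambda>s. Inf (A s))"
  have A_nonneg: "0 \<le> \<alpha>" if "\<alpha> \<in> A s" "s\<^sub>0 \<le> s" for \<alpha> s
    using that up by (auto simp: A_def Arg_less_0)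
  have bdd: "bdd_below (A s)" if "s\<^sub>0 \<le> s" for s
    using A_nonneg that by (intro bdd_belowI[of _ 0]) auto
  \<comment> \<open>With the next fact this traps the direction of every chord of a piece [s, t]
    between \<open>\<theta> s\<close> and \<open>\<theta> t\<close>.\<close>
  have \<theta>_le_Arg: "\<theta> s \<le> Arg (g z - g w)" if "s\<^sub>0 \<le> s" "s \<le> w" "w < z" "z \<le> b" for s w z
    unfolding \<theta>_def by (rule cInf_lower) (use that bdd in \<open>auto simp: A_def\<close>)
  have Arg_le_\<theta>: "Arg (g z - g w) \<le> \<theta> t" if "s\<^sub>0 \<le> w" "w < z" "z \<le> t" for t w z
    unfolding \<theta>_def
  proof (rule cInf_greatest)
    fix \<alpha> assume "\<alpha> \<in> A t"
    then consider "\<alpha> = pi" | w' z' where "\<alpha> = Arg (g z' - g w')" "t \<le> w'" "w' < z'" "z' \<le> b"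
      by (auto simp: A_def)
    then show "Arg (g z - g w) \<le> \<alpha>"
    proof cases
      case 1
      then show ?thesis by (simp add: Arg_le_pi)
    next
      case 2
      \<comment> \<open>If the two chords are separated, the chord from \<open>z\<close> to
        \<open>w'\<close> bridges the gap.\<close>
      have "Arg (g z - g w) \<le> Arg (g z' - g w')" if "z < w'"
        using turn[of w z w'] turn[of z w' z'] that 2 \<open>s\<^sub>0 \<le> w\<close> \<open>w < z\<close> by auto
      moreover have "Arg (g z - g w) \<le> Arg (g z' - g w')" if "z = w'"
        using turn[of w z z'] that 2 \<open>s\<^sub>0 \<le> w\<close> \<open>w < z\<close> by auto
      ultimately show ?thesis using 2 \<open>z \<le> t\<close> by fastforce
    qed
  qed (auto simp: A_def)
  have \<theta>_nonneg: "0 \<le> \<theta> s" if "s\<^sub>0 \<le> s" for s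
    unfolding \<theta>_def by (rule cInf_greatest) (use A_nonneg that in \<open>auto simp: A_def\<close>)
  have \<theta>_le_pi: "\<theta> s \<le> pi" if "s\<^sub>0 \<le> s" for s
    unfolding \<theta>_def by (rule cInf_lower) (use bdd that in \<open>auto simp: A_def\<close>)
  have \<theta>_mono: "\<theta> s \<le> \<theta> t" if "s\<^sub>0 \<le> s" "s \<le> t" for s t
    unfolding \<theta>_def
  proof (rule cInf_superset_mono)
    show "A t \<subseteq> A s" using that by (fastforce simp: A_def)
  qed (use bdd that in \<open>auto simp: A_def\<close>)

  have growth: "\<exists>u v. s\<^sub>0 \<le> u \<and> u \<le> x \<and> x \<le> v \<and> v \<le> s \<and> u < v \<and> v - u < d \<and> m * (v - u) \<le> \<theta> v - \<theta> u"
    if x: "s\<^sub>0 < x" "x < s" "x \<notin> N" and "s \<le> b" "0 < d" and m: "0 < m" "m < k" for x s d m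
  proof (rule ccontr)
    assume "\<not> ?thesis"
    then have slow: "\<theta> v - \<theta> u < m * (v - u)"
      if "s\<^sub>0 \<le> u" "u \<le> x" "x \<le> v" "v \<le> s" "u < v" "v - u < d" for u v
      using that by (meson not_le)
    obtain \<delta> where \<delta>: "\<delta> > 0" "\<And>r. 0 < r \<Longrightarrow> r < \<delta> \<Longrightarrow> m * dist (g (x - r)) (g (x + r)) < 2 * sin (m * r)"
      using good[OF x(3)] m unfolding short_chords_def by blast
    \<comment> \<open>Small enough for the chord hypothesis, for \<open>slow\<close>, for
      [x - r, x + r] to stay inside the range, and for angles up to \<open>m * r\<close> to lie in
      [0, pi], where cosine decreases.\<close>
    define r where "r = Min {\<delta> / 2, d / 3, x - s\<^sub>0, s - x, pi / m}"
    have r: "0 < r" using \<delta>(1) \<open>0 < d\<close> x m by (simp add: r_def)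
    have "r \<le> \<delta> / 2" "r \<le> d / 3" and rs: "r \<le> x - s\<^sub>0" "r \<le> s - x" and "r \<le> pi / m"
      unfolding r_def by (rule Min_le; simp)+
    then have r_d: "r < \<delta>" "r < d" and "m * r \<le> pi"
      using \<delta>(1) \<open>0 < d\<close> m by (auto simp: field_simps)
    define \<phi> where "\<phi> = \<theta> x"
    have near: "\<bar>\<theta> y - \<phi>\<bar> \<le> m * \<bar>y - x\<bar>" if y: "x - r \<le> y" "y \<le> x + r" for y
    proof (cases y x rule: linorder_cases)
      case less
      then show ?thesis using slow[of y x] \<theta>_mono[of y x] y rs r_d x by (simp add: \<phi>_def)
    next
      case greater
      then show ?thesis using slow[of x y] \<theta>_mono[of x y] y rs r_d x by (simp add: \<phi>_def)
    qed (simp add: \<phi>_def)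
    \<comment> \<open>Progress in the direction \<open>\<phi>\<close> at the centre; by
      \<open>near\<close>, chord directions deviate from it no more than on a circle of curvature
      \<open>m\<close>.\<close>
    define F where "F = (\<lambda>y. Re (cis (- \<phi>) * g y))"
    have "(sin (m * (x + r - x)) - sin (m * (x - r - x))) / m \<le> F (x + r) - F (x - r)"
    proof (rule increment_ge_integral_cos)
      fix p q assume pq: "x - r \<le> p" "p < q" "q \<le> x + r"
      \<comment> \<open>The endpoint farther from \<open>x\<close>: its deviation bounds that of all
        chords of [p, q].\<close>
      define \<xi> where "\<xi> = (if \<bar>p - x\<bar> \<le> \<bar>q - x\<bar> then q else p)"
      have \<xi>: "\<xi> \<in> {p..q}" "\<bar>p - x\<bar> \<le> \<bar>\<xi> - x\<bar>" "\<bar>q - x\<bar> \<le> \<bar>\<xi> - x\<bar>"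
        using pq by (auto simp: \<xi>_def)
      have "\<bar>\<xi> - x\<bar> \<le> r" using \<xi>(1) pq by auto
      then have M: "m * \<bar>\<xi> - x\<bar> \<le> pi"
        using \<open>m * r \<le> pi\<close> m(1) by (meson mult_left_mono less_imp_le order_trans)
      have "cos (m * \<bar>\<xi> - x\<bar>) * (q - p) \<le> Re (cis (- \<phi>) * (g q - g p))"
      proof (rule curve_length_chord_bound)
        show "curve_length g p q = ereal (q - p)" using len pq rs \<open>s \<le> b\<close> by simp
        fix w z assume wz: "p \<le> w" "w < z" "z \<le> q"
        have "\<theta> p \<le> Arg (g z - g w)" "Arg (g z - g w) \<le> \<theta> q"
          using \<theta>_le_Arg[of p w z] Arg_le_\<theta>[of w z q] pq wz rs \<open>s \<le> b\<close> by auto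
        moreover have "m * \<bar>p - x\<bar> \<le> m * \<bar>\<xi> - x\<bar>" "m * \<bar>q - x\<bar> \<le> m * \<bar>\<xi> - x\<bar>"
          using \<xi> m(1) by simp_all
        ultimately have "\<bar>Arg (g z - g w) - \<phi>\<bar> \<le> m * \<bar>\<xi> - x\<bar>"
          using near[of p] near[of q] pq by linarith
        then have "cos (m * \<bar>\<xi> - x\<bar>) \<le> cos (Arg (g z - g w) - \<phi>)"
          using M by (rule cos_le_cos_of_abs_le)
        then show "cos (m * \<bar>\<xi> - x\<bar>) * dist (g w) (g z) \<le> Re (cis (- \<phi>) * (g z - g w))"
          unfolding Re_cis_mult_Arg
          by (simp add: dist_norm norm_minus_commute mult.commute mult_left_mono)
      qed (use pq in simp)
      moreover have "cos (m * \<bar>\<xi> - x\<bar>) = cos (m * (\<xi> - x))"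
        using m(1) cos_abs_real[of "m * (\<xi> - x)"] by (simp add: abs_mult)
      ultimately show "\<exists>\<xi>\<in>{p..q}. (q - p) * cos (m * (\<xi> - x)) \<le> F q - F p"
        using \<xi>(1) by (intro bexI[of _ \<xi>]) (auto simp: F_def algebra_simps)
    qed (use r m in auto)
    also have "F (x + r) - F (x - r) = Re (cis (- \<phi>) * (g (x + r) - g (x - r)))"
      by (simp add: F_def algebra_simps)
    also have "\<dots> \<le> cmod (cis (- \<phi>) * (g (x + r) - g (x - r)))" by (rule complex_Re_le_cmod)
    also have "\<dots> = dist (g (x - r)) (g (x + r))" by (simp add: norm_mult dist_norm norm_minus_commute)
    finally show False using \<delta>(2)[OF r r_d(1)] m by (simp add: field_simps)
  qed
  have \<theta>_ge: "k * (s - s\<^sub>0) \<le> \<theta> s" if s: "s\<^sub>0 \<le> s" "s \<le> b" for s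
  \<comment> \<open>\<open>growth\<close> is available only for rates below \<open>k\<close>, so the
    rate \<open>z * k\<close> is taken with \<open>z\<close> arbitrarily close to 1.\<close>
  proof (rule field_le_mult_one_interval)
    fix z :: real assume z: "0 < z" "z < 1"
    have "z * k * (s - s\<^sub>0) \<le> \<theta> s - \<theta> s\<^sub>0"
    proof (rule mono_growth_from_small_intervals[OF _ _ _ N])
      show "mono_on {s\<^sub>0..s} \<theta>" by (auto simp: mono_on_def intro: \<theta>_mono)
      show "\<exists>u v. s\<^sub>0 \<le> u \<and> u \<le> x \<and> x \<le> v \<and> v \<le> s \<and> u < v \<and> v - u < d \<and> z * k * (v - u) \<le> \<theta> v - \<theta> u"
        if "s\<^sub>0 < x" "x < s" "x \<notin> N" "0 < d" for x d
        using growth[of x s d "z * k"] that z s \<open>0 < k\<close> by simp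
    qed (use s z \<open>0 < k\<close> in auto)
    then show "z * (k * (s - s\<^sub>0)) \<le> \<theta> s" using \<theta>_nonneg[of s\<^sub>0] by (simp add: mult.assoc)
  qed
  show "k * (b - s\<^sub>0) \<le> pi" using \<theta>_ge[of b] \<theta>_le_pi[of b] \<open>s\<^sub>0 \<le> b\<close> by simp

  have "Re (g b) - Re (g s\<^sub>0) \<le> (sin (k * (b - s\<^sub>0)) - sin (k * (s\<^sub>0 - s\<^sub>0))) / k"
  proof (rule increment_le_integral_cos)
    fix s t assume st: "s\<^sub>0 \<le> s" "s < t" "t \<le> b"
    \<comment> \<open>An upper bound for the real part is wanted, so the chord bound is applied in
      the opposite direction, with a factor \<open>- cos (\<theta> s)\<close> that may have either
      sign.\<close>
    have "- cos (\<theta> s) * (t - s) \<le> Re ((- 1) * (g t - g s))"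
    proof (rule curve_length_chord_bound)
      show "curve_length g s t = ereal (t - s)" using len st by simp
      fix w z assume wz: "s \<le> w" "w < z" "z \<le> t"
      have "cos (Arg (g z - g w)) \<le> cos (\<theta> s)"
        using \<theta>_le_Arg[of s w z] \<theta>_nonneg[of s] Arg_le_pi st wz by (intro cos_monotone_0_pi_le) auto
      then have "cmod (g z - g w) * cos (Arg (g z - g w)) \<le> cmod (g z - g w) * cos (\<theta> s)"
        by (intro mult_left_mono) auto
      moreover have "Re (g z - g w) = cmod (g z - g w) * cos (Arg (g z - g w))"
        using Re_cis_mult_Arg[of 0 "g z - g w"] by simp
      ultimately show "- cos (\<theta> s) * dist (g w) (g z) \<le> Re ((- 1) * (g z - g w))"
        by (simp add: dist_norm norm_minus_commute mult.commute)
    qed (use st in simp)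
    then have "Re (g t) - Re (g s) \<le> cos (\<theta> s) * (t - s)" by simp
    also have "\<dots> \<le> cos (k * (s - s\<^sub>0)) * (t - s)"
      using \<theta>_ge[of s] \<theta>_le_pi[of s] \<open>0 < k\<close> st by (intro mult_right_mono cos_monotone_0_pi_le) auto
    finally show "\<exists>\<xi>\<in>{s..t}. Re (g t) - Re (g s) \<le> (t - s) * cos (k * (\<xi> - s\<^sub>0))"
      using st by (intro bexI[of _ s]) (auto simp: mult.commute)
  qed (use assms in auto)
  then show "Re (g b) - Re (g s\<^sub>0) \<le> sin (k * (b - s\<^sub>0)) / k" by simp
qed

section \<open>Comparison for left-turning arcs\<close>

text \<open>\<open>Im (cnj u * v)\<close> is the determinant of \<open>u\<close> and
  \<open>v\<close>, twice a signed triangle area; the weak inequality admits straight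
  pieces.\<close>

definition left_turning :: "(real \<Rightarrow> complex) \<Rightarrow> real \<Rightarrow> real \<Rightarrow> bool" where
  "left_turning g a b \<longleftrightarrow>
     (\<forall>p q r. a \<le> p \<and> p \<le> q \<and> q \<le> r \<and> r \<le> b \<longrightarrow> 0 \<le> Im (cnj (g q - g p) * (g r - g p)))"

lemma left_turningD:
  assumes "left_turning g a b" "a \<le> p" "p \<le> q" "q \<le> r" "r \<le> b"
  shows "0 \<le> (Re (g q) - Re (g p)) * (Im (g r) - Im (g p)) - (Im (g q) - Im (g p)) * (Re (g r) - Re (g p))"
  using assms unfolding left_turning_def by (fastforce simp: algebra_simps)

text \<open>The determinant is |p| |q| sin (Arg q - Arg p), and both arguments lie in [0, pi]. With
  a nonnegative sine they can decrease only from pi to 0, the reversal that the last hypothesis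
  excludes.\<close>

lemma Arg_le_Arg_if_left_turn:
  assumes "p \<noteq> 0" "q \<noteq> 0" "0 \<le> Im p" "0 \<le> Im q" "0 \<le> Im (cnj p * q)"
    and "\<not> (Im p = 0 \<and> Im q = 0 \<and> Re p < 0 \<and> 0 < Re q)"
  shows "Arg p \<le> Arg q"
proof (rule ccontr)
  assume "\<not> Arg p \<le> Arg q"
  then have less: "Arg q < Arg p" by simp
  have bounds: "0 \<le> Arg q" "Arg p \<le> pi" using assms by (auto simp: Arg_less_0 Arg_le_pi)
  have "cnj p * q = cnj (rcis (cmod p) (Arg p)) * rcis (cmod q) (Arg q)" by (simp add: rcis_cmod_Arg)
  also have "\<dots> = rcis (cmod p * cmod q) (Arg q - Arg p)" by (simp add: rcis_def cis_cnj cis_mult algebra_simps)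
  finally have "Im (cnj p * q) = cmod p * cmod q * sin (Arg q - Arg p)" by simp
  then have "0 \<le> sin (Arg q - Arg p)"
    using assms by (metis mult_pos_pos zero_less_norm_iff zero_le_mult_iff not_less)
  then have "sin (Arg p - Arg q) \<le> 0" using sin_minus[of "Arg p - Arg q"] by simp
  moreover have "0 < sin (Arg p - Arg q)" if "Arg p - Arg q < pi"
    using less that by (intro sin_gt_zero) auto
  ultimately have "Arg p = pi" "Arg q = 0" using bounds by linarith+
  then have "Re p < 0" "Im p = 0" "q \<in> \<real>" "0 \<le> Re q" by (auto simp: Arg_eq_pi Arg_eq_0)
  moreover have "Im q = 0" using \<open>q \<in> \<real>\<close> by (simp add: complex_is_Real_iff)
  moreover have "Re q \<noteq> 0" using \<open>q \<noteq> 0\<close> \<open>Im q = 0\<close> by (auto simp: complex_eq_iff)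
  ultimately show False using assms(6) by simp
qed

text \<open>Normal form: the chord is horizontal and directed to the right, the left-turning arc
  lies below it, and \<open>s\<^sub>0\<close> is a lowest point, hence farthest from the
  chord.\<close>

context
  fixes g :: "real \<Rightarrow> complex" and a b s\<^sub>0 :: real
  assumes left: "left_turning g a b"
    and chord: "Im (g a) = Im (g b)" "Re (g a) < Re (g b)"
    and s\<^sub>0: "a \<le> s\<^sub>0" "s\<^sub>0 \<le> b" "\<And>t. a \<le> t \<Longrightarrow> t \<le> b \<Longrightarrow> Im (g s\<^sub>0) \<le> Im (g t)"
begin

lemma left_turning_below_chord:
  assumes "a \<le> t" "t \<le> b"
  shows "Im (g t) \<le> Im (g a)"
proof -
  have "0 \<le> - ((Im (g t) - Im (g a)) * (Re (g b) - Re (g a)))"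
    using left_turningD[OF left, of a t b] assms chord by simp
  then show ?thesis using chord by (simp add: mult_le_0_iff)
qed

text \<open>A descent from \<open>s\<close> to \<open>t\<close> after the lowest point is
  incompatible with left turns at the triples \<open>s\<^sub>0, s, t\<close>,
  \<open>s\<^sub>0, s, b\<close> and \<open>a, s, t\<close>.\<close>

lemma left_turning_Im_mono:
  assumes "s\<^sub>0 \<le> s" "s \<le> t" "t \<le> b"
  shows "Im (g s) \<le> Im (g t)"
proof (rule ccontr)
  assume "\<not> ?thesis"
  then have down: "Im (g t) < Im (g s)" by simp
  define x\<^sub>0 x\<^sub>1 h\<^sub>0 h\<^sub>1 H xa xb where defs: "x\<^sub>0 = Re (g s\<^sub>0) - Re (g s)" "x\<^sub>1 = Re (g t) - Re (g s)"
    "h\<^sub>0 = Im (g s) - Im (g s\<^sub>0)" "h\<^sub>1 = Im (g s) - Im (g t)" "H = Im (g a) - Im (g s)"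
    "xa = Re (g a) - Re (g s)" "xb = Re (g b) - Re (g s)"
  have h: "0 < h\<^sub>0" "0 < h\<^sub>1" "0 \<le> H" "xa < xb"
    using down s\<^sub>0(3)[of t] left_turning_below_chord[of s] assms s\<^sub>0(1) chord by (auto simp: defs)
  have 1: "0 \<le> x\<^sub>0 * h\<^sub>1 - x\<^sub>1 * h\<^sub>0"
    using left_turningD[OF left, of s\<^sub>0 s t] assms s\<^sub>0 by (simp add: defs algebra_simps)
  have 2: "0 \<le> - (xb * h\<^sub>0 + H * x\<^sub>0)"
    using left_turningD[OF left, of s\<^sub>0 s b] assms s\<^sub>0 by (simp add: defs chord(1) algebra_simps)
  have 3: "0 \<le> x\<^sub>1 * H + h\<^sub>1 * xa"
    using left_turningD[OF left, of a s t] assms s\<^sub>0 by (simp add: defs algebra_simps)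
  have "0 < h\<^sub>0 * h\<^sub>1 * (xb - xa)" using h by simp
  \<comment> \<open>These weights cancel \<open>x\<^sub>0\<close> and \<open>x\<^sub>1\<close>,
    leaving only the length of the chord with a negative factor.\<close>
  moreover have "0 \<le> H * (x\<^sub>0 * h\<^sub>1 - x\<^sub>1 * h\<^sub>0) + h\<^sub>1 * (- (xb * h\<^sub>0 + H * x\<^sub>0)) + h\<^sub>0 * (x\<^sub>1 * H + h\<^sub>1 * xa)"
    by (intro add_nonneg_nonneg mult_nonneg_nonneg 1 2 3 less_imp_le[OF h(1)] less_imp_le[OF h(2)] h(3))
  then have "0 \<le> - (h\<^sub>0 * h\<^sub>1 * (xb - xa))" by (simp add: algebra_simps)
  ultimately show False by simp
qed

lemma left_turning_Arg_mono:
  assumes inj: "inj_on g {a..b}" and cont: "continuous_on {a..b} g"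
    and "s\<^sub>0 \<le> s" "s < t" "t < w" "w \<le> b"
  shows "Arg (g t - g s) \<le> Arg (g w - g t)"
proof (rule Arg_le_Arg_if_left_turn)
  have neq: "g x \<noteq> g y" if "a \<le> x" "x < y" "y \<le> b" for x y
    using inj_onD[OF inj, of x y] that by auto
  show "g t - g s \<noteq> 0" "g w - g t \<noteq> 0" using neq[of s t] neq[of t w] assms s\<^sub>0 by auto
  show "0 \<le> Im (g t - g s)" "0 \<le> Im (g w - g t)"
    using left_turning_Im_mono[of s t] left_turning_Im_mono[of t w] assms by auto
  have "0 \<le> Im (cnj (g t - g s) * (g w - g s))"
    using left assms s\<^sub>0 unfolding left_turning_def by auto
  then show "0 \<le> Im (cnj (g t - g s) * (g w - g t))" by (simp add: algebra_simps)
  \<comment> \<open>A horizontal reversal puts both \<open>a\<close> and the lowest point on the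
    same line, so the whole arc is horizontal. Being injective and continuous, its real part is
    monotone; increasing contradicts the step from \<open>s\<close> to \<open>t\<close>, decreasing
    the direction of the chord.\<close>
  show "\<not> (Im (g t - g s) = 0 \<and> Im (g w - g t) = 0 \<and> Re (g t - g s) < 0 \<and> 0 < Re (g w - g t))"
  proof
    assume "Im (g t - g s) = 0 \<and> Im (g w - g t) = 0 \<and> Re (g t - g s) < 0 \<and> 0 < Re (g w - g t)"
    then have flat: "Im (g t) = Im (g s)" "Im (g w) = Im (g s)" and retro: "Re (g t) < Re (g s)" "Re (g t) < Re (g w)"
      by auto
    have "0 \<le> (Re (g t) - Re (g s)) * (Im (g a) - Im (g s))"
      using left_turningD[OF left, of a s t] assms s\<^sub>0 by (simp add: flat algebra_simps)
    then have ya: "Im (g a) = Im (g s)"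
      using left_turning_below_chord[of s] assms s\<^sub>0 retro by (simp add: zero_le_mult_iff)
    have "0 \<le> (Re (g w) - Re (g t)) * (Im (g s\<^sub>0) - Im (g s))"
      using left_turningD[OF left, of s\<^sub>0 t w] assms s\<^sub>0 by (simp add: flat algebra_simps)
    then have "Im (g s) \<le> Im (g s\<^sub>0)" using retro by (simp add: zero_le_mult_iff)
    moreover have "Im (g s\<^sub>0) \<le> Im (g s)" using assms s\<^sub>0(1) by (intro s\<^sub>0(3)) auto
    ultimately have "Im (g s\<^sub>0) = Im (g s)" by simp
    then have const: "Im (g x) = Im (g s)" if "x \<in> {a..b}" for x
      using left_turning_below_chord[of x] s\<^sub>0(3)[of x] that ya by auto
    have "inj_on (\<lambda>x. Re (g x)) {a..b}"
      using const by (intro inj_onI inj_onD[OF inj]) (auto simp: complex_eq_iff)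
    then have "strict_mono_on {a..b} (\<lambda>x. Re (g x)) \<or> strict_antimono_on {a..b} (\<lambda>x. Re (g x))"
      using cont by (subst (asm) injective_eq_monotone_map) (auto intro!: continuous_intros is_interval_cc)
    then show False
    proof
      assume "strict_mono_on {a..b} (\<lambda>x. Re (g x))"
      then have "Re (g s) < Re (g t)" using assms s\<^sub>0 by (auto simp: monotone_on_def)
      then show False using retro by simp
    next
      assume "strict_antimono_on {a..b} (\<lambda>x. Re (g x))"
      then have "Re (g b) < Re (g a)" using assms s\<^sub>0 by (auto simp: monotone_on_def)
      then show False using chord by simp
    qed
  qed
qed

end

section \<open>Isometries, reversal and the comparison for whole arcs\<close>

lemma curve_length_cong_dist:
  fixes f :: "real \<Rightarrow> 'a::metric_space" and g :: "real \<Rightarrow> 'b::metric_space"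
  assumes "\<And>s t. dist (f s) (f t) = dist (g s) (g t)"
  shows "curve_length f = curve_length g"
  by (intro ext) (simp add: curve_length_def assms)

text \<open>Negating and reversing a partition keeps its polygon length; the converse inequality is
  the same fact for the reversed curve.\<close>

lemma curve_length_reverse: "curve_length (\<lambda>t. g (- t)) (- t) (- s) = curve_length g s t"
proof -
  have le: "curve_length g s t \<le> curve_length (\<lambda>t. g (- t)) (- t) (- s)" for g :: "real \<Rightarrow> 'a" and s t
    unfolding curve_length_def
  proof (rule SUP_mono)
    fix ts assume "ts \<in> {ts. sorted ts \<and> ts \<noteq> [] \<and> hd ts = s \<and> last ts = t}"
    then have ts: "sorted ts" "ts \<noteq> []" "hd ts = s" "last ts = t" by auto
    define us where "us = rev (map uminus ts)"
    have "sorted us" using ts(1)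
      by (simp add: us_def sorted_wrt_rev sorted_wrt_map)
    moreover have "us \<noteq> []" "hd us = - t" "last us = - s"
      using ts by (auto simp: us_def hd_rev last_rev last_map hd_map)
    moreover have "(\<Sum>i<length ts - 1. dist (g (ts ! i)) (g (ts ! Suc i)))
       = (\<Sum>i<length us - 1. dist (g (- (us ! i))) (g (- (us ! Suc i))))"
    proof -
      have "(\<Sum>i<length ts - 1. dist (g (ts ! i)) (g (ts ! Suc i)))
         = (\<Sum>i<length ts - 1. dist (g (ts ! (length ts - 1 - Suc i))) (g (ts ! Suc (length ts - 1 - Suc i))))"
        by (rule sum.nat_diff_reindex[symmetric])
      also have "\<dots> = (\<Sum>i<length us - 1. dist (g (- (us ! i))) (g (- (us ! Suc i))))"
      proof (rule sum.cong)
        fix i assume "i \<in> {..<length us - 1}"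
        then have i: "i < length ts - 1" by (simp add: us_def)
        then have "- (us ! i) = ts ! Suc (length ts - 1 - Suc i)" "- (us ! Suc i) = ts ! (length ts - 1 - Suc i)"
          by (auto simp: us_def rev_nth Suc_diff_Suc)
        then show "dist (g (ts ! (length ts - 1 - Suc i))) (g (ts ! Suc (length ts - 1 - Suc i)))
            = dist (g (- (us ! i))) (g (- (us ! Suc i)))" by (simp add: dist_commute)
      qed (simp add: us_def)
      finally show ?thesis .
    qed
    ultimately show "\<exists>us\<in>{ts. sorted ts \<and> ts \<noteq> [] \<and> hd ts = - t \<and> last ts = - s}.
        ereal (\<Sum>i<length ts - 1. dist (g (ts ! i)) (g (ts ! Suc i)))
        \<le> ereal (\<Sum>i<length us - 1. dist (g (- (us ! i))) (g (- (us ! Suc i))))"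
      by (intro bexI[of _ us]) auto
  qed
  show ?thesis using le[of g s t] le[of "\<lambda>t. g (- t)" "- t" "- s"] by simp
qed

lemma arc_comparison_real_chord:
  fixes g :: "real \<Rightarrow> complex"
  assumes "a < b" "0 < k" and left: "left_turning g a b" and inj: "inj_on g {a..b}"
    and chord: "Im (g a) = Im (g b)" "Re (g a) < Re (g b)"
    and cont: "continuous_on {a..b} g"
    and len: "\<And>s t. a \<le> s \<Longrightarrow> s \<le> t \<Longrightarrow> t \<le> b \<Longrightarrow> curve_length g s t = ereal (t - s)"
    and N: "negligible N" and good: "\<And>x. x \<notin> N \<Longrightarrow> short_chords g k x"
  shows "k * (b - a) \<le> 2 * pi \<and> k * (Re (g b) - Re (g a)) \<le> 2 * sin (k * (b - a) / 2)"
proof -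
  have "continuous_on {a..b} (\<lambda>t. Im (g t))" using cont by (intro continuous_intros)
  then obtain s\<^sub>0 where s\<^sub>0: "a \<le> s\<^sub>0" "s\<^sub>0 \<le> b" "\<And>t. a \<le> t \<Longrightarrow> t \<le> b \<Longrightarrow> Im (g s\<^sub>0) \<le> Im (g t)"
    using continuous_attains_inf[of "{a..b}" "\<lambda>t. Im (g t)"] \<open>a < b\<close> by auto
  note half = half_arc_comparison[OF s\<^sub>0(2) \<open>0 < k\<close> len left_turning_Im_mono[OF left chord s\<^sub>0]
      left_turning_Arg_mono[OF left chord s\<^sub>0 inj cont] N good]
  have right: "k * (b - s\<^sub>0) \<le> pi" "Re (g b) - Re (g s\<^sub>0) \<le> sin (k * (b - s\<^sub>0)) / k"
    subgoal by (rule half(1)) (use s\<^sub>0(1) in simp_all)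
    subgoal by (rule half(2)) (use s\<^sub>0(1) in simp_all)
    done

  \<comment> \<open>Reflection in the imaginary axis together with reversal of the parameter
    preserves heights, left turns and the direction of the chord, and turns the left half into a
    right half.\<close>
  define h where "h = (\<lambda>t. - cnj (g (- t)))"
  have Re_h: "Re (h t) = - Re (g (- t))" and Im_h: "Im (h t) = Im (g (- t))" for t by (simp_all add: h_def)
  have dist_h: "dist (h s) (h t) = dist (g (- s)) (g (- t))" for s t
    unfolding h_def dist_norm by (metis complex_cnj_diff complex_mod_cnj minus_diff_minus norm_minus_cancel)
  have left_h: "left_turning h (- b) (- a)"
    unfolding left_turning_def
  proof (intro allI impI)
    fix p q r assume "- b \<le> p \<and> p \<le> q \<and> q \<le> r \<and> r \<le> - a"
    then show "0 \<le> Im (cnj (h q - h p) * (h r - h p))"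
      using left_turningD[OF left, of "- r" "- q" "- p"] by (simp add: Re_h Im_h algebra_simps)
  qed
  have inj_h: "inj_on h {- b..- a}"
  proof (rule inj_onI)
    fix x y assume "x \<in> {- b..- a}" "y \<in> {- b..- a}" "h x = h y"
    then have "- x \<in> {a..b}" "- y \<in> {a..b}" "g (- x) = g (- y)" by (auto simp: h_def)
    then have "- x = - y" by (intro inj_onD[OF inj])
    then show "x = y" by simp
  qed
  have cont_h: "continuous_on {- b..- a} h"
    unfolding h_def
    by (intro continuous_intros continuous_on_compose2[OF cont]) auto
  have len_h: "curve_length h s t = ereal (t - s)" if "- b \<le> s" "s \<le> t" "t \<le> - a" for s t
  proof -
    have "curve_length h = curve_length (\<lambda>t. g (- t))" by (rule curve_length_cong_dist) (rule dist_h)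
    then show ?thesis using curve_length_reverse[of g "- s" "- t"] len[of "- t" "- s"] that by simp
  qed
  have N_h: "negligible (uminus ` N)"
    by (rule negligible_differentiable_image_negligible[OF _ N]) (auto intro!: derivative_intros simp: differentiable_on_def)
  have good_h: "short_chords h k x" if "x \<notin> uminus ` N" for x
  proof -
    have "- x \<notin> N" using that by force
    then have "short_chords g k (- x)" by (rule good)
    moreover have "dist (h (x - r)) (h (x + r)) = dist (g (- x - r)) (g (- x + r))" for r
    proof -
      have "- (x - r) = - x + r" "- (x + r) = - x - r" by simp_all
      then show ?thesis unfolding dist_h by (simp only: dist_commute)
    qed
    ultimately show ?thesis by (simp add: short_chords_def)
  qed
  have chord_h: "Im (h (- b)) = Im (h (- a))" "Re (h (- b)) < Re (h (- a))"
    using chord by (simp_all add: Re_h Im_h)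
  have s\<^sub>0_h: "- b \<le> - s\<^sub>0" "- s\<^sub>0 \<le> - a" "\<And>t. - b \<le> t \<Longrightarrow> t \<le> - a \<Longrightarrow> Im (h (- s\<^sub>0)) \<le> Im (h t)"
    using s\<^sub>0 by (auto simp: Im_h)
  note half_h = half_arc_comparison[OF s\<^sub>0_h(2) \<open>0 < k\<close> len_h left_turning_Im_mono[OF left_h chord_h s\<^sub>0_h]
      left_turning_Arg_mono[OF left_h chord_h s\<^sub>0_h inj_h cont_h] N_h good_h]
  have "k * (- a - - s\<^sub>0) \<le> pi" "Re (h (- a)) - Re (h (- s\<^sub>0)) \<le> sin (k * (- a - - s\<^sub>0)) / k"
    subgoal by (rule half_h(1)) (use s\<^sub>0_h(1) in simp_all)
    subgoal by (rule half_h(2)) (use s\<^sub>0_h(1) in simp_all)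
    done
  then have left': "k * (s\<^sub>0 - a) \<le> pi" "Re (g s\<^sub>0) - Re (g a) \<le> sin (k * (s\<^sub>0 - a)) / k"
    by (simp_all add: Re_h)

  define \<alpha> \<beta> where "\<alpha> = k * (b - s\<^sub>0)" and "\<beta> = k * (s\<^sub>0 - a)"
  have ab: "0 \<le> \<alpha>" "\<alpha> \<le> pi" "0 \<le> \<beta>" "\<beta> \<le> pi" "\<alpha> + \<beta> = k * (b - a)"
    using right left' s\<^sub>0 \<open>0 < k\<close> by (auto simp: \<alpha>_def \<beta>_def algebra_simps)
  have "Re (g b) - Re (g a) \<le> (sin \<alpha> + sin \<beta>) / k"
    using right left' by (simp add: \<alpha>_def \<beta>_def add_divide_distrib)
  then have "k * (Re (g b) - Re (g a)) \<le> sin \<alpha> + sin \<beta>" using \<open>0 < k\<close> by (simp add: field_simps)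
  also have "\<dots> = 2 * sin ((\<alpha> + \<beta>) / 2) * cos ((\<alpha> - \<beta>) / 2)" by (rule sin_plus_sin)
  also have "\<dots> \<le> 2 * sin ((\<alpha> + \<beta>) / 2)"
    using ab by (intro mult_left_le) (auto intro!: sin_ge_zero)
  finally show ?thesis using ab by simp
qed

lemma cnj_sgn_mult: "cnj (sgn z) * z = of_real (cmod z)"
proof (cases "z = 0")
  case False
  have "cnj (sgn z) * z = (z * cnj z) / of_real (cmod z)" by (simp add: sgn_eq)
  also have "\<dots> = of_real ((cmod z)\<^sup>2) / of_real (cmod z)" by (simp only: complex_norm_square)
  also have "\<dots> = of_real (cmod z)" using False by (simp add: power2_eq_square)
  finally show ?thesis .
qed simp

lemma arc_comparison:
  fixes g :: "real \<Rightarrow> complex"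
  assumes "a < b" "0 < k" and left: "left_turning g a b" and inj: "inj_on g {a..b}"
    and cont: "continuous_on {a..b} g"
    and len: "\<And>s t. a \<le> s \<Longrightarrow> s \<le> t \<Longrightarrow> t \<le> b \<Longrightarrow> curve_length g s t = ereal (t - s)"
    and N: "negligible N" and good: "\<And>x. x \<notin> N \<Longrightarrow> short_chords g k x"
  shows "k * (b - a) \<le> 2 * pi \<and> k * dist (g a) (g b) \<le> 2 * sin (k * (b - a) / 2)"
proof -
  have "g b - g a \<noteq> 0" using inj_onD[OF inj, of a b] \<open>a < b\<close> by auto
  \<comment> \<open>Multiplication by this unit number rotates the chord onto the positive real
    axis; by \<open>uu\<close> it preserves determinants, hence left turns.\<close>
  define u where "u = cnj (sgn (g b - g a))"
  have u: "cmod u = 1" using \<open>g b - g a \<noteq> 0\<close> by (simp add: u_def norm_sgn)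
  have uu: "cnj u * u = 1" using u complex_norm_square[of u] by (simp add: mult.commute)
  define h where "h = (\<lambda>t. u * g t)"
  have dist_h: "dist (h s) (h t) = dist (g s) (g t)" for s t
    unfolding h_def dist_norm by (simp add: u norm_mult flip: right_diff_distrib)
  have "h b - h a = cnj (sgn (g b - g a)) * (g b - g a)" by (simp add: h_def u_def right_diff_distrib)
  also have "\<dots> = of_real (dist (g a) (g b))"
    unfolding cnj_sgn_mult by (simp add: dist_norm norm_minus_commute)
  finally have hba: "h b - h a = of_real (dist (g a) (g b))" .
  have Reh: "Re (h b) - Re (h a) = dist (g a) (g b)" and Imh: "Im (h b) - Im (h a) = 0"
    unfolding minus_complex.simps[symmetric] hba by simp_all
  have "k * (b - a) \<le> 2 * pi \<and> k * (Re (h b) - Re (h a)) \<le> 2 * sin (k * (b - a) / 2)"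
  proof (rule arc_comparison_real_chord[OF \<open>a < b\<close> \<open>0 < k\<close> _ _ _ _ _ _ N])
    show "left_turning h a b"
      unfolding left_turning_def
    proof (intro allI impI)
      fix p q r assume pqr: "a \<le> p \<and> p \<le> q \<and> q \<le> r \<and> r \<le> b"
      have "cnj (h q - h p) * (h r - h p) = (cnj u * u) * (cnj (g q - g p) * (g r - g p))"
        by (simp add: h_def algebra_simps)
      then show "0 \<le> Im (cnj (h q - h p) * (h r - h p))"
        using left pqr unfolding uu left_turning_def by simp
    qed
    show "inj_on h {a..b}"
      using u by (intro inj_onI inj_onD[OF inj]) (auto simp: h_def)
    show "Im (h a) = Im (h b)" using Imh by simp
    have "0 < dist (g a) (g b)" using \<open>g b - g a \<noteq> 0\<close> by auto
    then show "Re (h a) < Re (h b)" using Reh by linarith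
    show "continuous_on {a..b} h" unfolding h_def by (intro continuous_intros cont)
    show "curve_length h s t = ereal (t - s)" if "a \<le> s" "s \<le> t" "t \<le> b" for s t
      using len[OF that] curve_length_cong_dist[of h g] dist_h by simp
    show "short_chords h k x" if "x \<notin> N" for x
      using good[OF that] by (simp add: short_chords_def dist_h)
  qed
  then show ?thesis by (simp only: Reh)
qed

section \<open>Orientation of arcs seen from an interior point\<close>

text \<open>Seen from the origin, \<open>y\<close> lies between \<open>x\<close> and
  \<open>z\<close> within less than a half-turn, so y = A x + B z with A, B > 0. \<open>star\<close>
  keeps \<open>y\<close> out of the triangle 0, x, z except for its side xz, so A + B \<ge> 1 and
  \<open>y\<close> lies on or beyond the line through \<open>x\<close> and \<open>z\<close>.\<close>

lemma left_turn_if_not_inside_triangle: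
  fixes x y z :: complex
  assumes xyz: "x = rcis \<rho>\<^sub>1 \<phi>" "y = rcis \<rho>\<^sub>2 (\<phi> + \<alpha>)" "z = rcis \<rho>\<^sub>3 (\<phi> + \<alpha> + \<beta>)"
    and pos: "0 < \<rho>\<^sub>1" "0 < \<rho>\<^sub>2" "0 < \<rho>\<^sub>3" and angles: "0 < \<alpha>" "0 < \<beta>" "\<alpha> + \<beta> < pi"
    and star: "\<And>l m. 0 \<le> l \<Longrightarrow> l < 1 \<Longrightarrow> 0 \<le> m \<Longrightarrow> m \<le> 1 \<Longrightarrow>
      y \<noteq> of_real l * (of_real (1 - m) * x + of_real m * z)"
  shows "0 \<le> Im (cnj (y - x) * (z - x))"
proof -
  have s: "0 < sin \<alpha>" "0 < sin \<beta>" "0 < sin (\<alpha> + \<beta>)" using angles by (auto intro!: sin_gt_zero)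
  \<comment> \<open>The middle direction expanded in the two outer ones, by the addition
    formulas.\<close>
  have cis: "of_real (sin (\<alpha> + \<beta>)) * cis (\<phi> + \<alpha>) = of_real (sin \<beta>) * cis \<phi> + of_real (sin \<alpha>) * cis (\<phi> + \<alpha> + \<beta>)"
  proof -
    have *: "sin (\<alpha> + \<beta>) * cos \<tau> = sin \<beta> * cos (\<tau> - \<alpha>) + sin \<alpha> * cos (\<tau> + \<beta>)"
      "sin (\<alpha> + \<beta>) * sin \<tau> = sin \<beta> * sin (\<tau> - \<alpha>) + sin \<alpha> * sin (\<tau> + \<beta>)" for \<tau>
      unfolding sin_add cos_add sin_diff cos_diff by (simp_all add: algebra_simps)
    show ?thesis using *[of "\<phi> + \<alpha>"] by (simp add: complex_eq_iff)
  qed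
  define A where "A = \<rho>\<^sub>2 * sin \<beta> / (\<rho>\<^sub>1 * sin (\<alpha> + \<beta>))"
  define B where "B = \<rho>\<^sub>2 * sin \<alpha> / (\<rho>\<^sub>3 * sin (\<alpha> + \<beta>))"
  have AB: "0 < A" "0 < B" using s pos by (auto simp: A_def B_def)
  have "of_real (sin (\<alpha> + \<beta>)) * y = of_real \<rho>\<^sub>2 * (of_real (sin (\<alpha> + \<beta>)) * cis (\<phi> + \<alpha>))"
    by (simp add: xyz rcis_def)
  also have "\<dots> = of_real (\<rho>\<^sub>2 * sin \<beta>) * cis \<phi> + of_real (\<rho>\<^sub>2 * sin \<alpha>) * cis (\<phi> + \<alpha> + \<beta>)"
    unfolding cis by (simp add: algebra_simps)
  also have "\<dots> = of_real (sin (\<alpha> + \<beta>)) * (of_real A * x + of_real B * z)"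
  proof -
    have "\<rho>\<^sub>2 * sin \<beta> = sin (\<alpha> + \<beta>) * A * \<rho>\<^sub>1" "\<rho>\<^sub>2 * sin \<alpha> = sin (\<alpha> + \<beta>) * B * \<rho>\<^sub>3"
      using s pos by (simp_all add: A_def B_def)
    then show ?thesis by (simp add: xyz rcis_def algebra_simps)
  qed
  finally have "y = of_real A * x + of_real B * z"
    using s(3) by (simp only: mult_cancel_left of_real_eq_0_iff) simp
  also have "\<dots> = of_real (A + B) * (of_real (1 - B / (A + B)) * x + of_real (B / (A + B)) * z)"
  proof -
    have "A = (A + B) * (1 - B / (A + B))" "B = (A + B) * (B / (A + B))"
      using AB by (simp_all add: field_simps)
    then have "complex_of_real A = of_real (A + B) * of_real (1 - B / (A + B))"
      "complex_of_real B = of_real (A + B) * of_real (B / (A + B))"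
      by (metis of_real_mult)+
    then show ?thesis by (simp only: distrib_left mult.assoc)
  qed
  finally have "\<not> A + B < 1" using star[of "A + B" "B / (A + B)"] AB by (auto simp: field_simps)
  \<comment> \<open>Clearing denominators turns A + B \<ge> 1 into an inequality between the doubled
    areas of the triangles 0xy, 0yz and 0xz, whose signed sum is the wanted determinant.\<close>
  then have "\<rho>\<^sub>1 * \<rho>\<^sub>3 * sin (\<alpha> + \<beta>) \<le> \<rho>\<^sub>1 * \<rho>\<^sub>3 * sin (\<alpha> + \<beta>) * (A + B)"
    using s pos mult_left_mono[of 1 "A + B" "\<rho>\<^sub>1 * \<rho>\<^sub>3 * sin (\<alpha> + \<beta>)"] by simp
  also have "\<dots> = \<rho>\<^sub>2 * \<rho>\<^sub>3 * sin \<beta> + \<rho>\<^sub>1 * \<rho>\<^sub>2 * sin \<alpha>"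
    using s pos by (simp add: A_def B_def field_simps)
  finally have "0 \<le> \<rho>\<^sub>1 * \<rho>\<^sub>2 * sin \<alpha> + \<rho>\<^sub>2 * \<rho>\<^sub>3 * sin \<beta> - \<rho>\<^sub>1 * \<rho>\<^sub>3 * sin (\<alpha> + \<beta>)" by simp
  also have "\<dots> = Im (cnj (y - x) * (z - x))"
  proof -
    have "Im (cnj (y - x) * (z - x)) = Im (cnj x * y) + Im (cnj y * z) - Im (cnj x * z)"
      by (simp add: algebra_simps)
    moreover have cross: "Im (cnj (rcis r s) * rcis r' s') = r * r' * sin (s' - s)" for r r' s s'
      by (simp add: sin_diff algebra_simps)
    ultimately show ?thesis unfolding xyz cross by (simp add: add.assoc)
  qed
  finally show ?thesis .
qed

lemma Im_cnj_rotate: "Im (cnj (q - p) * (r - p)) = Im (cnj (r - q) * (p - q))"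
  by (simp add: algebra_simps)

text \<open>\<open>star\<close>: no point of the arc is a point of one of its chords shrunk towards
  the origin, as on the boundary of a convex set with the origin inside. The case
  \<open>l = 0\<close> excludes the origin itself.\<close>

context
  fixes g :: "real \<Rightarrow> complex" and a b :: real
  assumes inj: "inj_on g {a..b}"
    and star: "\<And>t p r l m. t \<in> {a..b} \<Longrightarrow> p \<in> {a..b} \<Longrightarrow> r \<in> {a..b} \<Longrightarrow> 0 \<le> l \<Longrightarrow> l < 1 \<Longrightarrow> 0 \<le> m \<Longrightarrow> m \<le> 1 \<Longrightarrow>
      g t \<noteq> of_real l * (of_real (1 - m) * g p + of_real m * g r)"
begin

text \<open>The nearer of two points on a ray would be the farther one scaled by some
  \<open>l < 1\<close>; \<open>n\<close> allows polar angles that differ by full turns.\<close>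

lemma ray_inj:
  assumes s: "s \<in> {a..b}" "t \<in> {a..b}" and "g s = rcis \<rho> \<phi>" "g t = rcis \<rho>' (\<phi> + 2 * pi * of_int n)" "0 < \<rho>" "0 < \<rho>'"
  shows "s = t"
proof -
  have "cis (\<phi> + 2 * pi * of_int n) = cis \<phi>" by (simp add: cis_mult[symmetric] cis_multiple_2pi)
  then have t: "g t = rcis \<rho>' \<phi>" using assms by (simp add: rcis_def)
  have le: False if "u \<in> {a..b}" "v \<in> {a..b}" "g u = rcis r \<phi>" "g v = rcis r' \<phi>" "0 < r" "r < r'" for u v r r'
    using star[of u v v "r / r'" 0] that by (auto simp: rcis_def)
  have "\<rho> = \<rho>'" using le[OF s assms(3) t] le[OF s(2,1) t assms(3)] assms by fastforce
  then show ?thesis using inj_onD[OF inj] s assms(3) t by metis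
qed

text \<open>The angular gaps \<alpha>, \<beta> and 2 pi - \<alpha> - \<beta> make a full turn. If
  one exceeds pi, the triangle lemma applies to the other two after a cyclic shift; otherwise the
  origin lies in the triangle and all three signed areas are nonnegative.\<close>

lemma left_turning_if_polar_angle_increasing:
  fixes \<rho> \<psi> :: "real \<Rightarrow> real"
  assumes g: "\<And>t. t \<in> {a..b} \<Longrightarrow> g t = rcis (\<rho> t) (\<psi> t)" and pos: "\<And>t. 0 < \<rho> t"
    and cont: "continuous_on {a..b} \<psi>" and mono: "strict_mono_on {a..b} \<psi>"
  shows "left_turning g a b"
  unfolding left_turning_def
proof (intro allI impI)
  fix p q r assume pqr: "a \<le> p \<and> p \<le> q \<and> q \<le> r \<and> r \<le> b"
  show "0 \<le> Im (cnj (g q - g p) * (g r - g p))"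
  proof (cases "p = q \<or> q = r")
    case True
    then show ?thesis by (auto simp: algebra_simps)
  next
    case False
    then have less: "p < q" "q < r" and mem: "p \<in> {a..b}" "q \<in> {a..b}" "r \<in> {a..b}" using pqr by auto
    define \<alpha> \<beta> where "\<alpha> = \<psi> q - \<psi> p" and "\<beta> = \<psi> r - \<psi> q"
    have ab: "0 < \<alpha>" "0 < \<beta>" using mono less mem by (auto simp: \<alpha>_def \<beta>_def monotone_on_def)
    \<comment> \<open>After a full turn the arc would meet the ray through \<open>g p\<close> again,
      by the intermediate value theorem.\<close>
    have "\<psi> r < \<psi> p + 2 * pi"
    proof (rule ccontr)
      assume "\<not> ?thesis"
      then obtain t where t: "p \<le> t" "t \<le> r" "\<psi> t = \<psi> p + 2 * pi"
        using IVT'[of \<psi> p "\<psi> p + 2 * pi" r] continuous_on_subset[OF cont, of "{p..r}"] less mem by auto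
      then have "p = t" using ray_inj[of p t "\<rho> p" "\<psi> p" "\<rho> t" 1] g pos mem by auto
      then show False using t by simp
    qed
    then have sum: "\<alpha> + \<beta> < 2 * pi" by (simp add: \<alpha>_def \<beta>_def)
    have gp: "g p = rcis (\<rho> p) (\<psi> p)" and gq: "g q = rcis (\<rho> q) (\<psi> q)" and gr: "g r = rcis (\<rho> r) (\<psi> r)"
      using g mem by auto
    have gp': "g p = rcis (\<rho> p) (\<psi> p + 2 * pi)" and gq': "g q = rcis (\<rho> q) (\<psi> q + 2 * pi)"
      unfolding gp gq by (simp_all add: rcis_def cis_mult[symmetric])
    consider "\<alpha> + \<beta> < pi" | "\<alpha> > pi" | "\<beta> > pi" | "\<alpha> \<le> pi" "\<beta> \<le> pi" "\<alpha> + \<beta> \<ge> pi" by linarith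
    then show ?thesis
    proof cases
      case 1
      show ?thesis
        by (rule left_turn_if_not_inside_triangle[of _ "\<rho> p" "\<psi> p" _ "\<rho> q" \<alpha> _ "\<rho> r" \<beta>])
          (use 1 gp gq gr pos ab star[OF mem(2) mem(1) mem(3)] in \<open>auto simp: \<alpha>_def \<beta>_def\<close>)
    next
      case 2
      have "0 \<le> Im (cnj (g r - g q) * (g p - g q))"
        by (rule left_turn_if_not_inside_triangle[of _ "\<rho> q" "\<psi> q" _ "\<rho> r" \<beta> _ "\<rho> p" "2 * pi - \<alpha> - \<beta>"])
          (use 2 gp' gq gr pos ab sum star[OF mem(3) mem(2) mem(1)] in \<open>auto simp: \<alpha>_def \<beta>_def algebra_simps\<close>)
      then show ?thesis by (simp only: Im_cnj_rotate[of "g q" "g p"])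
    next
      case 3
      have "0 \<le> Im (cnj (g p - g r) * (g q - g r))"
        by (rule left_turn_if_not_inside_triangle[of _ "\<rho> r" "\<psi> r" _ "\<rho> p" "2 * pi - \<alpha> - \<beta>" _ "\<rho> q" \<alpha>])
          (use 3 gp' gq' gr pos ab sum star[OF mem(1) mem(3) mem(2)] in \<open>auto simp: \<alpha>_def \<beta>_def algebra_simps\<close>)
      then show ?thesis by (simp only: Im_cnj_rotate[of "g q" "g p"] Im_cnj_rotate[of "g r" "g q"])
    next
      case 4
      have cross: "Im (cnj (rcis r s) * rcis r' s') = r * r' * sin (s' - s)" for r r' s s'
        by (simp add: sin_diff algebra_simps)
      have "Im (cnj (g q - g p) * (g r - g p)) = Im (cnj (g p) * g q) + Im (cnj (g q) * g r) - Im (cnj (g p) * g r)"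
        by (simp add: algebra_simps)
      also have "\<dots> = \<rho> p * \<rho> q * sin \<alpha> + \<rho> q * \<rho> r * sin \<beta> - \<rho> p * \<rho> r * sin (\<alpha> + \<beta>)"
        unfolding gp gq gr cross by (simp add: \<alpha>_def \<beta>_def)
      moreover have "0 \<le> sin \<alpha>" "0 \<le> sin \<beta>" "sin (\<alpha> + \<beta>) \<le> 0"
        using 4 ab sum by (auto intro!: sin_ge_zero sin_le_zero)
      ultimately show ?thesis using pos[of p] pos[of q] pos[of r]
        by (simp add: add_nonneg_nonneg mult_nonneg_nonpos2 order_trans[of _ 0] mult_nonneg_nonpos)
    qed
  qed
qed

end

text \<open>By \<open>star\<close>, every ray from the origin meets the arc at most once, so its polar angle is
  strictly monotone.\<close>

lemma star_arc_left_turning: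
  fixes g :: "real \<Rightarrow> complex"
  assumes cont: "continuous_on {a..b} g" and inj: "inj_on g {a..b}"
    and star: "\<And>t p r l m. t \<in> {a..b} \<Longrightarrow> p \<in> {a..b} \<Longrightarrow> r \<in> {a..b} \<Longrightarrow> 0 \<le> l \<Longrightarrow> l < 1 \<Longrightarrow> 0 \<le> m \<Longrightarrow> m \<le> 1 \<Longrightarrow>
      g t \<noteq> of_real l * (of_real (1 - m) * g p + of_real m * g r)"
  shows "left_turning g a b \<or> left_turning (\<lambda>t. cnj (g t)) a b"
proof -
  have "g t \<noteq> 0" if "t \<in> {a..b}" for t using star[of t t t 0 0] that by auto
  \<comment> \<open>An interval is contractible, so \<open>g\<close> has a continuous logarithm,
    whose imaginary part is a continuous polar angle.\<close>
  then obtain G where G: "continuous_on {a..b} G" "\<And>t. t \<in> {a..b} \<Longrightarrow> g t = exp (G t)"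
    using continuous_logarithm_on_contractible[OF cont convex_imp_contractible] by blast
  define \<rho> \<psi> where "\<rho> = (\<lambda>t. exp (Re (G t)))" and "\<psi> = (\<lambda>t. Im (G t))"
  have g: "g t = rcis (\<rho> t) (\<psi> t)" if "t \<in> {a..b}" for t
    using G(2)[OF that] by (simp add: \<rho>_def \<psi>_def rcis_def exp_eq_polar)
  have pos: "0 < \<rho> t" for t by (simp add: \<rho>_def)
  have cont_\<psi>: "continuous_on {a..b} \<psi>" unfolding \<psi>_def by (intro continuous_intros G(1))
  have "inj_on \<psi> {a..b}"
  proof (rule inj_onI)
    fix s t assume "s \<in> {a..b}" "t \<in> {a..b}" "\<psi> s = \<psi> t"
    then show "s = t" using ray_inj[OF inj star, of s t "\<rho> s" "\<psi> s" "\<rho> t" 0] g pos by auto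
  qed
  then consider "strict_mono_on {a..b} \<psi>" | "strict_antimono_on {a..b} \<psi>"
    using injective_eq_monotone_map[OF is_interval_cc cont_\<psi>] by blast
  then show ?thesis
  proof cases
    case 1
    then show ?thesis using left_turning_if_polar_angle_increasing[OF inj star g pos cont_\<psi>] by blast
  next
    case 2
    \<comment> \<open>A decreasing polar angle means a clockwise traversal, which conjugation
      reverses.\<close>
    have "left_turning (\<lambda>t. cnj (g t)) a b"
    proof (rule left_turning_if_polar_angle_increasing[where \<rho> = \<rho> and \<psi> = "\<lambda>t. - \<psi> t"])
      show "inj_on (\<lambda>t. cnj (g t)) {a..b}" using inj by (simp add: inj_on_def)
      show "cnj (g t) = rcis (\<rho> t) (- \<psi> t)" if "t \<in> {a..b}" for t
        using g[OF that] by (simp add: rcis_def cis_cnj)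
      show "strict_mono_on {a..b} (\<lambda>t. - \<psi> t)" using 2 by (simp add: monotone_on_def)
      show "cnj (g t) \<noteq> of_real l * (of_real (1 - m) * cnj (g p) + of_real m * cnj (g r))"
        if "t \<in> {a..b}" "p \<in> {a..b}" "r \<in> {a..b}" "0 \<le> l" "l < 1" "0 \<le> m" "m \<le> 1" for t p r l m
      proof -
        have "of_real l * (of_real (1 - m) * cnj (g p) + of_real m * cnj (g r))
          = cnj (of_real l * (of_real (1 - m) * g p + of_real m * g r))" by simp
        then show ?thesis using star[OF that] by (simp only: complex_cnj_cancel_iff not_False_eq_True)
      qed
    qed (use pos cont_\<psi> in \<open>auto intro!: continuous_intros\<close>)
    then show ?thesis ..
  qed
qed

section \<open>Closed convex curves\<close>

definition complex_of_vec :: "real^2 \<Rightarrow> complex" where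
  "complex_of_vec v = Complex (v $ 1) (v $ 2)"

lemma complex_of_vec_linear [simp]:
  "complex_of_vec (u + v) = complex_of_vec u + complex_of_vec v"
  "complex_of_vec (u - v) = complex_of_vec u - complex_of_vec v"
  "complex_of_vec (c *\<^sub>R v) = of_real c * complex_of_vec v"
  by (simp_all add: complex_of_vec_def complex_eq_iff)

lemma cmod_complex_of_vec: "cmod (complex_of_vec v) = norm v"
  by (simp add: complex_of_vec_def cmod_def norm_vec_def L2_set_def UNIV_2)

lemma dist_complex_of_vec: "dist (complex_of_vec u) (complex_of_vec v) = dist u v"
  by (simp add: dist_norm cmod_complex_of_vec flip: complex_of_vec_linear)

lemma complex_of_vec_eq_iff: "complex_of_vec u = complex_of_vec v \<longleftrightarrow> u = v"
  by (metis dist_complex_of_vec dist_eq_0_iff)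

context
  fixes \<gamma> :: "real \<Rightarrow> real^2" and L :: real
  assumes curve: "closed_convex_curve_al \<gamma> L"
begin

lemma curve_length_eq: "a \<le> b \<Longrightarrow> curve_length \<gamma> a b = ereal (b - a)"
  using curve by (simp add: closed_convex_curve_al_def)

lemma period_pos: "0 < L"
  using curve by (simp add: closed_convex_curve_al_def)

lemma curve_dist_le: "a \<le> b \<Longrightarrow> dist (\<gamma> a) (\<gamma> b) \<le> b - a"
  using dist_le_curve_length[of a b \<gamma>] curve_length_eq[of a b] by simp

lemma curve_continuous: "continuous_on S \<gamma>"
proof (rule continuous_on_subset[of UNIV])
  have "dist (\<gamma> s) (\<gamma> t) \<le> dist s t" for s t
    using curve_dist_le[of s t] curve_dist_le[of t s] by (cases "s \<le> t") (auto simp: dist_commute dist_real_def)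
  then show "continuous_on UNIV \<gamma>"
    unfolding continuous_on_iff by (meson le_less_trans)
qed simp

lemma curve_period_int: "\<gamma> (t + of_int n * L) = \<gamma> t"
proof (induction n arbitrary: t rule: int_induct[where k = 0])
  case (step1 n)
  have "\<gamma> (t + of_int (n + 1) * L) = \<gamma> ((t + of_int n * L) + L)" by (simp add: algebra_simps)
  then show ?case using curve step1 by (simp add: closed_convex_curve_al_def)
next
  case (step2 n)
  have "\<gamma> (t + of_int (n - 1) * L) = \<gamma> ((t + of_int (n - 1) * L) + L)"
    using curve by (simp add: closed_convex_curve_al_def)
  then show ?case using step2 by (simp add: algebra_simps)
qed simp

lemma reduce_mod_period:
  obtains n :: int and t' where "t = t' + of_int n * L" "0 \<le> t'" "t' < L"
proof
  show "t = (t - of_int \<lfloor>t / L\<rfloor> * L) + of_int \<lfloor>t / L\<rfloor> * L" by simp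
  have "of_int \<lfloor>t / L\<rfloor> * L \<le> t / L * L" "t / L * L < (of_int \<lfloor>t / L\<rfloor> + 1) * L"
    using period_pos by (intro mult_right_mono mult_strict_right_mono; linarith)+
  then show "0 \<le> t - of_int \<lfloor>t / L\<rfloor> * L" "t - of_int \<lfloor>t / L\<rfloor> * L < L"
    using period_pos by (simp_all add: algebra_simps)
qed

text \<open>Equal points reduce to the same parameter in [0, L), so \<open>s - t\<close> is an
  integer multiple of \<open>L\<close> of absolute value below \<open>L\<close>.\<close>

lemma curve_inj_on:
  assumes "b - a < L"
  shows "inj_on \<gamma> {a..b}"
proof (rule inj_onI)
  fix s t assume st: "s \<in> {a..b}" "t \<in> {a..b}" "\<gamma> s = \<gamma> t"
  obtain n s' where s: "s = s' + of_int n * L" "0 \<le> s'" "s' < L" by (rule reduce_mod_period)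
  obtain m t' where t: "t = t' + of_int m * L" "0 \<le> t'" "t' < L" by (rule reduce_mod_period)
  have "inj_on \<gamma> {0..<L}" using curve by (simp add: closed_convex_curve_al_def)
  moreover have "\<gamma> s' = \<gamma> t'" using st(3) unfolding s(1) t(1) curve_period_int .
  ultimately have "s' = t'" using s t by (auto dest: inj_onD)
  then have eq: "s - t = of_int (n - m) * L" using s t by (simp add: algebra_simps)
  have "\<bar>s - t\<bar> < L" using st assms by auto
  then have "\<bar>of_int (n - m) :: real\<bar> * L < 1 * L" unfolding eq abs_mult using period_pos by simp
  then have "\<bar>of_int (n - m) :: real\<bar> < 1" using period_pos by (simp only: mult_less_cancel_right_pos)
  then have "n = m" by linarith
  then show "s = t" using eq by simp
qed

text \<open>\<open>c\<close> is an interior point: shrinking a point of the convex body towards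
  \<open>c\<close> by a factor below 1 leads into the interior, away from the frontier.\<close>

lemma curve_star_shaped:
  obtains c where "\<And>t p r l m. 0 \<le> l \<Longrightarrow> l < 1 \<Longrightarrow> 0 \<le> m \<Longrightarrow> m \<le> 1 \<Longrightarrow>
    \<gamma> t - c \<noteq> l *\<^sub>R ((1 - m) *\<^sub>R (\<gamma> p - c) + m *\<^sub>R (\<gamma> r - c))"
proof -
  obtain C where C: "convex C" "compact C" "interior C \<noteq> {}" "\<gamma> ` {0..L} = frontier C"
    using curve by (auto simp: closed_convex_curve_al_def)
  then obtain c where c: "c \<in> interior C" by auto
  have fr: "\<gamma> t \<in> frontier C" for t
  proof -
    obtain n t' where t: "t = t' + of_int n * L" "0 \<le> t'" "t' < L" by (rule reduce_mod_period)
    have "\<gamma> t = \<gamma> t'" unfolding t(1) by (rule curve_period_int)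
    then show ?thesis using t C(4) by force
  qed
  have in_C: "\<gamma> t \<in> C" for t
    using fr[of t] frontier_subset_closed[OF compact_imp_closed[OF C(2)]] by blast
  show ?thesis
  proof (rule that[of c])
    fix t p r and l m :: real assume lm: "0 \<le> l" "l < 1" "0 \<le> m" "m \<le> 1"
    define x where "x = (1 - m) *\<^sub>R \<gamma> p + m *\<^sub>R \<gamma> r"
    have "x \<in> C" unfolding x_def by (rule convexD[OF C(1) in_C in_C]) (use lm in auto)
    then have "x - (1 - l) *\<^sub>R (x - c) \<in> interior C"
      using C(1) c lm by (intro mem_interior_convex_shrink) auto
    then have "\<gamma> t \<noteq> x - (1 - l) *\<^sub>R (x - c)" using fr[of t] by (auto simp: frontier_def)
    moreover have "c + l *\<^sub>R ((1 - m) *\<^sub>R (\<gamma> p - c) + m *\<^sub>R (\<gamma> r - c)) = x - (1 - l) *\<^sub>R (x - c)"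
      by (simp add: x_def algebra_simps)
    ultimately show "\<gamma> t - c \<noteq> l *\<^sub>R ((1 - m) *\<^sub>R (\<gamma> p - c) + m *\<^sub>R (\<gamma> r - c))"
      by (metis add_diff_cancel_left' diff_add_cancel add.commute)
  qed
qed

section \<open>From arc/chord curvature to short chords\<close>

lemma is_arc_curvature_kappa0:
  assumes "a < b"
  shows "is_arc_curvature (b - a) (dist (\<gamma> a) (\<gamma> b)) (kappa0 \<gamma> a b)"
  using assms curve_length_eq[of a b] curve_dist_le[of a b]
  by (simp add: kappa0_def is_arc_curvature_arc_chord_kappa)

text \<open>The lower limit is tested on the subarcs centred at \<open>x\<close>, of length
  \<open>2 * r\<close>; once their curvature exceeds \<open>m\<close>, their chords are shorter than
  those of the circle.\<close>

lemma short_chords_if_Liminf: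
  assumes "ereal k \<le> Liminf (subarcs_at x) (\<lambda>(a, b). ereal (kappa0 \<gamma> a b))"
  shows "short_chords \<gamma> k x"
  unfolding short_chords_def
proof (intro allI impI)
  fix m :: real assume m: "0 < m \<and> m < k"
  then have "\<forall>\<^sub>F I in subarcs_at x. ereal m < (\<lambda>(a, b). ereal (kappa0 \<gamma> a b)) I"
    using assms unfolding le_Liminf_iff by simp
  then obtain d where d: "0 < d" "\<And>I. I \<in> {(a, b). a \<le> x \<and> x \<le> b \<and> a < b} \<Longrightarrow> I \<noteq> (x, x) \<Longrightarrow>
      dist I (x, x) < d \<Longrightarrow> ereal m < (\<lambda>(a, b). ereal (kappa0 \<gamma> a b)) I"
    unfolding subarcs_at_def eventually_at by blast
  show "\<exists>\<delta>>0. \<forall>r. 0 < r \<and> r < \<delta> \<longrightarrow> m * dist (\<gamma> (x - r)) (\<gamma> (x + r)) < 2 * sin (m * r)"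
  proof (intro exI[of _ "d / 2"] conjI allI impI)
    fix r assume r: "0 < r \<and> r < d / 2"
    have "dist (x - r, x + r) (x, x) \<le> dist (x - r) x + dist (x + r) x"
      unfolding dist_Pair_Pair by (rule sqrt_sum_squares_le_sum) auto
    then have "dist (x - r, x + r) (x, x) < d" using r by (simp add: dist_real_def)
    then have "m < kappa0 \<gamma> (x - r) (x + r)" using d(2)[of "(x - r, x + r)"] r by auto
    then show "m * dist (\<gamma> (x - r)) (\<gamma> (x + r)) < 2 * sin (m * r)"
      using arc_curvature_chord_less[OF is_arc_curvature_kappa0, of "x - r" "x + r" m] r m by simp
  qed (use d(1) in simp)
qed

lemma short_chords_translate:
  assumes "short_chords \<gamma> k x"
  shows "short_chords \<gamma> k (x + of_int n * L)"
proof -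
  have "\<gamma> (x + of_int n * L - r) = \<gamma> (x - r)" "\<gamma> (x + of_int n * L + r) = \<gamma> (x + r)" for r
    using curve_period_int[of "x - r" n] curve_period_int[of "x + r" n] by (simp_all add: algebra_simps)
  then show ?thesis using assms by (simp add: short_chords_def)
qed

end

theorem theorem2p9:
  fixes \<gamma> :: "real \<Rightarrow> real^2" and L \<kappa> :: real
  assumes "closed_convex_curve_al \<gamma> L"
    and "\<kappa> > 0"
    and "AE s in lebesgue. s \<in> {0..L} \<longrightarrow>
           Liminf (subarcs_at s) (\<lambda>(a, b). ereal (kappa0 \<gamma> a b)) =
             Limsup (subarcs_at s) (\<lambda>(a, b). ereal (kappa0 \<gamma> a b)) \<and>
           Liminf (subarcs_at s) (\<lambda>(a, b). ereal (kappa0 \<gamma> a b)) \<ge> ereal \<kappa>"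
  shows "\<forall>a b. a < b \<and> b - a < L \<longrightarrow> kappa0 \<gamma> a b \<ge> \<kappa>"
proof (intro allI impI)
  fix a b :: real assume ab: "a < b \<and> b - a < L"
  note curve = assms(1)
  obtain N\<^sub>0 where N\<^sub>0: "negligible N\<^sub>0" "\<And>s. s \<notin> N\<^sub>0 \<Longrightarrow> s \<in> {0..L} \<Longrightarrow> short_chords \<gamma> \<kappa> s"
    using assms(3) short_chords_if_Liminf[OF curve] unfolding eventually_ae_filter_negligible by blast
  \<comment> \<open>The arc may leave [0, L], so the exceptional set is translated by all periods;
    countably many translates are still negligible.\<close>
  define N where "N = (\<Union>n::int. (+) (of_int n * L) ` N\<^sub>0)"
  have N: "negligible N"
    unfolding N_def by (intro negligible_countable_Union) (auto intro: negligible_translation N\<^sub>0)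
  have good: "short_chords \<gamma> \<kappa> x" if "x \<notin> N" for x
  proof -
    obtain n x' where x: "x = x' + of_int n * L" "0 \<le> x'" "x' < L" by (rule reduce_mod_period[OF curve])
    then have "x' \<notin> N\<^sub>0" using that by (force simp: N_def add.commute)
    then show ?thesis unfolding x(1) using x N\<^sub>0 by (intro short_chords_translate[OF curve]) auto
  qed
  obtain c where c: "\<And>t p r l m. 0 \<le> l \<Longrightarrow> l < 1 \<Longrightarrow> 0 \<le> m \<Longrightarrow> m \<le> 1 \<Longrightarrow>
      \<gamma> t - c \<noteq> l *\<^sub>R ((1 - m) *\<^sub>R (\<gamma> p - c) + m *\<^sub>R (\<gamma> r - c))"
    using curve_star_shaped[OF curve] by blast
  define g where "g = (\<lambda>t. complex_of_vec (\<gamma> t - c))"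
  have dist_g: "dist (g s) (g t) = dist (\<gamma> s) (\<gamma> t)" for s t
    unfolding g_def dist_complex_of_vec by (simp add: dist_norm)
  have cont: "continuous_on {a..b} g"
    using curve_continuous[OF curve, of "{a..b}"] unfolding continuous_on_iff dist_g .
  have inj: "inj_on g {a..b}"
    using curve_inj_on[OF curve, of b a] ab by (simp add: g_def inj_on_def complex_of_vec_eq_iff del: complex_of_vec_linear)
  have star: "g t \<noteq> of_real l * (of_real (1 - m) * g p + of_real m * g r)"
    if "0 \<le> l" "l < 1" "0 \<le> m" "m \<le> 1" for t p r l m
    using c[OF that, of t p r] unfolding g_def complex_of_vec_linear(1,3)[symmetric] complex_of_vec_eq_iff .
  \<comment> \<open>Stated for any isometric copy \<open>h\<close>, since a conjugation may be
    needed to make the arc left-turning.\<close>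
  have arc: "\<kappa> * (b - a) \<le> 2 * pi \<and> \<kappa> * dist (h a) (h b) \<le> 2 * sin (\<kappa> * (b - a) / 2)"
    if "left_turning h a b" and dist_h: "\<And>s t. dist (h s) (h t) = dist (\<gamma> s) (\<gamma> t)"
      and h: "continuous_on {a..b} h" "inj_on h {a..b}" for h
  proof (rule arc_comparison[OF _ \<open>\<kappa> > 0\<close> that(1) h(2,1) _ N])
    show "curve_length h s t = ereal (t - s)" if "s \<le> t" for s t
      using curve_length_eq[OF curve that] curve_length_cong_dist[of h \<gamma>] dist_h by simp
    show "short_chords h \<kappa> x" if "x \<notin> N" for x
      using good[OF that] by (simp add: short_chords_def dist_h)
  qed (use ab in simp)
  have "\<kappa> * (b - a) \<le> 2 * pi \<and> \<kappa> * dist (\<gamma> a) (\<gamma> b) \<le> 2 * sin (\<kappa> * (b - a) / 2)"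
    using star_arc_left_turning[OF cont inj star]
  proof
    assume "left_turning g a b"
    then show ?thesis using arc[OF _ dist_g cont inj] by (simp add: dist_g)
  next
    assume "left_turning (\<lambda>t. cnj (g t)) a b"
    moreover have dist_cnj: "dist (cnj (g s)) (cnj (g t)) = dist (\<gamma> s) (\<gamma> t)" for s t
      unfolding dist_g[symmetric] by (simp add: dist_norm flip: complex_cnj_diff)
    moreover have "continuous_on {a..b} (\<lambda>t. cnj (g t))" by (intro continuous_intros cont)
    moreover have "inj_on (\<lambda>t. cnj (g t)) {a..b}" using inj by (simp add: inj_on_def)
    ultimately show ?thesis using arc[of "\<lambda>t. cnj (g t)"] by simp
  qed
  \<comment> \<open>Were the curvature below \<kappa>, the chord would strictly exceed that of the
    circular arc.\<close>
  then show "kappa0 \<gamma> a b \<ge> \<kappa>"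
    using arc_curvature_chord_greater[OF is_arc_curvature_kappa0[OF curve], of a b \<kappa>] ab by force
qed

end
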